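(* Let $u_0\in\mathcal M$, and let $u$ be the solution of $\partial_tu=-\Pi_uP(\mathcal B)u$, $u(0)=u_0$. Then $$u(t)\longrightarrow u_\infty:=\frac{\mathsf E_*u_0}{\|\mathsf E_*u_0\|_H}\quad\text{strongly in }H\text{ as }t\to\infty .$$ The limit $u_\infty$ belongs to $\mathcal H_*\cap\mathcal M$ and is therefore an equilibrium of the flow (i.e. $u_\infty\in\mathcal D(P(\mathcal B))$ and $\Pi_{u_\infty}P(\mathcal B)u_\infty=0$). If $\Sigma_P(u_0)\setminus\{\mu_*(u_0)\}\neq\varnothing$, define the active spectral gap $$\delta_*(u_0):=\min\{\mu-\mu_*(u_0):\mu\in\Sigma_P(u_0),\ \mu>\mu_*(u_0)\}.$$ Then $\delta_*(u_0)>0$ and there exists a constant $C(u_0)>0$ such that $$\|u(t)-u_\infty\|_H\le C(u_0)e^{-\delta_*(u_0)t},\qquad t\ge0 .$$ If $\Sigma_P(u_0)=\{\mu_*(u_0)\}$, then $u(t)=u_0$ for every $t\ge0$. More generally, if $u_0\in\mathcal D(\mathcal A^\theta)\cap\mathcal M$ for some $\theta\ge0$, then $u(t)\to u_\infty$ in $\mathcal D(\mathcal A^\theta)$ as $t\to\infty$. If moreover $\Sigma_P(u_0)\setminus\{\mu_*(u_0)\}\neq\varnothing$ (so that the active spectral gap is defined), then there exists a constant $C_\theta(u_0)>0$, depending on $\theta$ and $u_0$, such that $$\|\mathcal A^\theta(u(t)-u_\infty)\|_H\le C_\theta(u_0)e^{-\delta_*(u_0)t},\qquad t\ge0 .$$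 Explicitly, with $w_*:=\mathsf E_*u_0$, $w_\perp:=(I-\mathsf E_* )u_0$ and $a:=\|w_*\|_H$, one may take $$C_\theta(u_0)=\frac{\|\mathcal A^\theta w_\perp\|_H}{a}+\frac{\|\mathcal A^\theta w_*\|_H\,\|w_\perp\|_H^2}{2a^3}.$$
   Context: Let $d\ge1$, let $\Omega\subset\mathbb R^d$ be a bounded connected domain with $C^\infty$ boundary, and let $H=L^2(\Omega)$ (real) with its usual inner product $\langle\cdot,\cdot\rangle_H$ and norm $\|\cdot\|_H$. Let $\mathcal B=-\Delta_D$ be the positive Dirichlet Laplacian, $\mathcal D(\mathcal B)=H^2(\Omega)\cap H^1_0(\Omega)$, with eigenvalues $0<\lambda_1\le\lambda_2\le\cdots$, $\lambda_j\to\infty$ (repeated according to multiplicity) and orthonormal basis $\{e_j\}_{j\ge1}$ of $H$ with $\mathcal Be_j=\lambda_je_j$. Let $P(s)=a_ms^m+\cdots+a_0$ be a real polynomial of degree $m\ge1$ with $a_m>0$. For $u=\sum_ju_je_j$, $u_j=\langle u,e_j\rangle_H$, set $P(\mathcal B)u=\sum_jP(\lambda_j)u_je_j$ on $\mathcal D(P(\mathcal B))=\{u\in H:\sum_j|P(\lambda_j)|^2|u_j|^2<\infty\}$ (graph norm), and $S_P(t)u=e^{-tP(\mathcal B)}u=\sum_je^{-tP(\lambda_j)}u_je_j$. Put $\mu_P=\min_{s\ge\lambda_1}P(s)$, fix $\kappa>\max\{0,1-\mu_P\}$, set $\mathcal A=P(\mathcal B)+\kappa I$, $q_j=P(\lambda_j)+\kappa\ge1$,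 and for $\theta\ge0$ set $\mathcal A^\theta u=\sum_jq_j^\theta u_je_j$ on $\mathcal D(\mathcal A^\theta)=\{u\in H:\sum_jq_j^{2\theta}|u_j|^2<\infty\}$ with norm $\|\mathcal A^\theta u\|_H$. Let $\mathcal M=\{u\in H:\|u\|_H=1\}$ and $\Pi_uv=v-\langle v,u\rangle_Hu$ for $u\in\mathcal M$, $v\in H$. The solution of $\partial_tu=-\Pi_uP(\mathcal B)u$ ($t>0$), $u(0)=u_0\in\mathcal M$, is the unique $\mathcal M$-valued solution in $C([0,\infty);H)\cap C((0,\infty);\mathcal D(P(\mathcal B)))\cap C^1((0,\infty);H)$, namely $u(t)=S_P(t)u_0/\|S_P(t)u_0\|_H$. The active polynomial spectral set of $u_0$ is $\Sigma_P(u_0)=\{P(\lambda_j):\langle u_0,e_j\rangle_H\ne0\}$; since $P(\lambda_j)\to+\infty$ it has a smallest element $\mu_*(u_0)=\min\Sigma_P(u_0)$. Let $\mathcal H_*=\ker(P(\mathcal B)-\mu_*(u_0)I)$ and let $\mathsf E_*$ be the orthogonal projection of $H$ onto $\mathcal H_*$ (so $\mathsf E_*u_0\ne0$). *)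

theory Defs
  imports "HOL-Analysis.Analysis" "HOL-Computational_Algebra.Polynomial"
begin

section \<open>The real Hilbert space of square-integrable functions\<close>

definition square_integrable :: "('a::euclidean_space \<Rightarrow> real) \<Rightarrow> bool" where
  "square_integrable f \<longleftrightarrow>
     f \<in> borel_measurable lebesgue \<and> integrable lebesgue (\<lambda>x. (f x)\<^sup>2)"

lemma square_integrable_zero [simp]: "square_integrable (\<lambda>_. 0)"
  by (simp add: square_integrable_def)

lemma square_integrable_prod:
  assumes "square_integrable f" "square_integrable g"
  shows "integrable lebesgue (\<lambda>x. f x * g x)"
proof (rule Bochner_Integration.integrable_bound)
  show "integrable lebesgue (\<lambda>x. (f x)\<^sup>2 + (g x)\<^sup>2)"
    using assms by (simp add: square_integrable_def)
  show "(\<lambda>x. f x * g x) \<in> borel_measurable lebesgue"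
    using assms by (auto simp: square_integrable_def)
  have "norm (f x * g x) \<le> norm ((f x)\<^sup>2 + (g x)\<^sup>2)" for x
  proof -
    have "2 * (\<bar>f x\<bar> * \<bar>g x\<bar>) \<le> (f x)\<^sup>2 + (g x)\<^sup>2"
      using sum_squares_bound[of "\<bar>f x\<bar>" "\<bar>g x\<bar>"] by simp
    moreover have "0 \<le> \<bar>f x\<bar> * \<bar>g x\<bar>" by simp
    ultimately have "\<bar>f x\<bar> * \<bar>g x\<bar> \<le> (f x)\<^sup>2 + (g x)\<^sup>2" by linarith
    then show ?thesis by (simp add: abs_mult)
  qed
  then show "AE x in lebesgue. norm (f x * g x) \<le> norm ((f x)\<^sup>2 + (g x)\<^sup>2)" by simp
qed

lemma square_integrable_add:
  assumes "square_integrable f" "square_integrable g"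
  shows "square_integrable (\<lambda>x. f x + g x)"
proof -
  have "integrable lebesgue (\<lambda>x. (f x)\<^sup>2 + 2 * (f x * g x) + (g x)\<^sup>2)"
    using assms square_integrable_prod[OF assms] by (simp add: square_integrable_def)
  moreover have "(\<lambda>x. (f x)\<^sup>2 + 2 * (f x * g x) + (g x)\<^sup>2) = (\<lambda>x. (f x + g x)\<^sup>2)"
    by (simp add: fun_eq_iff power2_eq_square algebra_simps)
  ultimately show ?thesis using assms by (auto simp: square_integrable_def)
qed

lemma square_integrable_scale:
  "square_integrable f \<Longrightarrow> square_integrable (\<lambda>x. c * f x)"
  by (auto simp: square_integrable_def power_mult_distrib)

lemma square_integrable_minus: "square_integrable f \<Longrightarrow> square_integrable (\<lambda>x. - f x)"
  using square_integrable_scale[of f "-1"] by simp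

lemma square_integrable_diff:
  "square_integrable f \<Longrightarrow> square_integrable g \<Longrightarrow> square_integrable (\<lambda>x. f x - g x)"
  using square_integrable_add[of f "\<lambda>x. - g x"] square_integrable_minus by auto

quotient_type (overloaded) 'a L2 = "'a::euclidean_space \<Rightarrow> real" / partial:
  "\<lambda>f g. square_integrable f \<and> square_integrable g \<and> (AE x in lebesgue. f x = g x)"
proof (rule part_equivpI)
  show "\<exists>f::'a \<Rightarrow> real. square_integrable f \<and> square_integrable f \<and> (AE x in lebesgue. f x = f x)"
    by (rule exI[of _ "\<lambda>_. 0"]) simp
  show "symp (\<lambda>f g :: 'a \<Rightarrow> real.
      square_integrable f \<and> square_integrable g \<and> (AE x in lebesgue. f x = g x))"
    by (auto simp: symp_def)
  show "transp (\<lambda>f g :: 'a \<Rightarrow> real.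
      square_integrable f \<and> square_integrable g \<and> (AE x in lebesgue. f x = g x))"
    by (auto simp: transp_def elim: eventually_elim2)
qed

instantiation L2 :: (euclidean_space) real_vector
begin

lift_definition zero_L2 :: "'a L2" is "\<lambda>_. 0" by simp

lift_definition plus_L2 :: "'a L2 \<Rightarrow> 'a L2 \<Rightarrow> 'a L2" is "\<lambda>f g x. f x + g x"
  by (auto intro: square_integrable_add elim: eventually_elim2)

lift_definition scaleR_L2 :: "real \<Rightarrow> 'a L2 \<Rightarrow> 'a L2" is "\<lambda>c f x. c * f x"
  by (auto intro: square_integrable_scale elim: eventually_mono)

lift_definition uminus_L2 :: "'a L2 \<Rightarrow> 'a L2" is "\<lambda>f x. - f x"
  by (auto intro: square_integrable_minus elim: eventually_mono)

lift_definition minus_L2 :: "'a L2 \<Rightarrow> 'a L2 \<Rightarrow> 'a L2" is "\<lambda>f g x. f x - g x"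
  by (auto intro: square_integrable_diff elim: eventually_elim2)

instance
proof
  fix u v w :: "'a L2" and a b :: real
  show "u + v + w = u + (v + w)"
    by transfer (auto intro!: square_integrable_add simp: add.assoc)
  show "u + v = v + u"
    by transfer (auto intro!: square_integrable_add simp: add.commute)
  show "0 + u = u" by transfer auto
  show "- u + u = 0"
    by transfer auto
  show "u - v = u + - v" by transfer (auto intro!: square_integrable_diff)
  show "a *\<^sub>R (u + v) = a *\<^sub>R u + a *\<^sub>R v"
    by transfer (auto intro!: square_integrable_add square_integrable_scale simp: algebra_simps)
  show "(a + b) *\<^sub>R u = a *\<^sub>R u + b *\<^sub>R u"
    by transfer (auto intro!: square_integrable_add square_integrable_scale simp: algebra_simps)
  show "a *\<^sub>R b *\<^sub>R u = (a * b) *\<^sub>R u"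
    by transfer (auto intro!: square_integrable_scale simp: algebra_simps)
  show "1 *\<^sub>R u = u" by transfer auto
qed

end

instantiation L2 :: (euclidean_space) real_inner
begin

lift_definition inner_L2 :: "'a L2 \<Rightarrow> 'a L2 \<Rightarrow> real"
  is "\<lambda>f g. integral\<^sup>L lebesgue (\<lambda>x. f x * g x)"
proof (rule integral_cong_AE, goal_cases)
  case (3 f f' g g')
  then have "AE x in lebesgue. f x = f' x" "AE x in lebesgue. g x = g' x" by auto
  then show ?case by eventually_elim simp
qed (auto simp: square_integrable_def)

definition norm_L2 :: "'a L2 \<Rightarrow> real" where "norm_L2 u = sqrt (inner u u)"
definition dist_L2 :: "'a L2 \<Rightarrow> 'a L2 \<Rightarrow> real" where "dist_L2 u v = norm (u - v)"
definition sgn_L2 :: "'a L2 \<Rightarrow> 'a L2" where "sgn_L2 u = u /\<^sub>R norm u"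
definition uniformity_L2 :: "('a L2 \<times> 'a L2) filter" where
  "uniformity_L2 = (INF e\<in>{0<..}. principal {(x, y). dist x y < e})"
definition open_L2 :: "'a L2 set \<Rightarrow> bool" where
  "open_L2 U \<longleftrightarrow> (\<forall>x\<in>U. eventually (\<lambda>(x', y). x' = x \<longrightarrow> y \<in> U) uniformity)"

instance
proof
  fix u v w :: "'a L2" and a :: real
  show "dist u v = norm (u - v)" by (simp add: dist_L2_def)
  show "sgn u = u /\<^sub>R norm u" by (simp add: sgn_L2_def)
  show "(uniformity :: ('a L2 \<times> 'a L2) filter) = (INF e\<in>{0<..}. principal {(x, y). dist x y < e})"
    by (simp add: uniformity_L2_def)
  show "open U \<longleftrightarrow> (\<forall>x\<in>U. eventually (\<lambda>(x', y). x' = x \<longrightarrow> y \<in> U) uniformity)" for U :: "'a L2 set"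
    by (simp add: open_L2_def)
  show "inner u v = inner v u" by transfer (simp add: mult.commute)
  show "inner (u + v) w = inner u w + inner v w"
    by transfer (simp add: distrib_right square_integrable_prod)
  show "inner (a *\<^sub>R u) v = a * inner u v"
    by transfer (simp add: mult.assoc)
  show "0 \<le> inner u u" by transfer simp
  show "inner u u = 0 \<longleftrightarrow> u = 0"
    by transfer (auto simp: integral_nonneg_eq_0_iff_AE square_integrable_def power2_eq_square)
  show "norm u = sqrt (inner u u)" by (simp add: norm_L2_def)
qed

end

text \<open>The class of a square-integrable function (and \<open>0\<close> if the function is not
  square-integrable).\<close>

lift_definition L2_class :: "('a::euclidean_space \<Rightarrow> real) \<Rightarrow> 'a L2"
  is "\<lambda>f. if square_integrable f then f else (\<lambda>_. 0)"
  by simp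

text \<open>The space \<open>L\<^sup>2(\<Omega>)\<close> is realised isometrically inside \<open>L\<^sup>2\<close> of the whole space by extension
  by zero.  Thus its norm and inner product are those of the ambient type.\<close>

lift_definition vanishes_outside :: "'a::euclidean_space set \<Rightarrow> 'a L2 \<Rightarrow> bool"
  is "\<lambda>\<Omega> f. AE x in lebesgue. x \<notin> \<Omega> \<longrightarrow> f x = 0"
  by (auto elim: eventually_elim2)

definition L2_on :: "'a::euclidean_space set \<Rightarrow> 'a L2 set" where
  "L2_on \<Omega> = {u. vanishes_outside \<Omega> u}"

section \<open>Smooth functions and smooth domains\<close>

definition partial_deriv :: "'a::euclidean_space \<Rightarrow> ('a \<Rightarrow> real) \<Rightarrow> 'a \<Rightarrow> real" where
  "partial_deriv i f = (\<lambda>x. frechet_derivative f (at x) i)"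

primrec C_k :: "nat \<Rightarrow> ('a::euclidean_space \<Rightarrow> real) \<Rightarrow> bool" where
  "C_k 0 f \<longleftrightarrow> continuous_on UNIV f"
| "C_k (Suc k) f \<longleftrightarrow> (\<forall>x. f differentiable (at x)) \<and> (\<forall>i\<in>Basis. C_k k (partial_deriv i f))"

definition smooth :: "('a::euclidean_space \<Rightarrow> real) \<Rightarrow> bool" where
  "smooth f \<longleftrightarrow> (\<forall>k. C_k k f)"

text \<open>Near each boundary point the domain is the region strictly above the graph of a smooth
  function of the coordinates orthogonal to some unit vector \<open>\<nu>\<close>.\<close>

definition smooth_boundary :: "'a::euclidean_space set \<Rightarrow> bool" where
  "smooth_boundary \<Omega> \<longleftrightarrow>
     (\<forall>p\<in>frontier \<Omega>. \<exists>r>0. \<exists>\<nu> \<gamma>. norm \<nu> = 1 \<and> smooth \<gamma> \<and>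
        \<Omega> \<inter> ball p r = {x \<in> ball p r. x \<bullet> \<nu> > \<gamma> (x - (x \<bullet> \<nu>) *\<^sub>R \<nu>)})"

definition smooth_bounded_domain :: "'a::euclidean_space set \<Rightarrow> bool" where
  "smooth_bounded_domain \<Omega> \<longleftrightarrow>
     open \<Omega> \<and> \<Omega> \<noteq> {} \<and> connected \<Omega> \<and> bounded \<Omega> \<and> smooth_boundary \<Omega>"

section \<open>Sobolev spaces and the Dirichlet Laplacian\<close>

definition test_functions :: "'a::euclidean_space set \<Rightarrow> ('a \<Rightarrow> real) set" where
  "test_functions \<Omega> =
     {\<phi>. smooth \<phi> \<and> compact (closure {x. \<phi> x \<noteq> 0}) \<and> closure {x. \<phi> x \<noteq> 0} \<subseteq> \<Omega>}"

definition is_weak_deriv ::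
    "'a::euclidean_space set \<Rightarrow> 'a \<Rightarrow> 'a L2 \<Rightarrow> 'a L2 \<Rightarrow> bool" where
  "is_weak_deriv \<Omega> i u v \<longleftrightarrow> v \<in> L2_on \<Omega> \<and>
     (\<forall>\<phi>\<in>test_functions \<Omega>. u \<bullet> L2_class (partial_deriv i \<phi>) = - (v \<bullet> L2_class \<phi>))"

definition weak_deriv :: "'a::euclidean_space set \<Rightarrow> 'a \<Rightarrow> 'a L2 \<Rightarrow> 'a L2" where
  "weak_deriv \<Omega> i u = (THE v. is_weak_deriv \<Omega> i u v)"

definition sobolev_H1 :: "'a::euclidean_space set \<Rightarrow> 'a L2 set" where
  "sobolev_H1 \<Omega> = {u \<in> L2_on \<Omega>. \<forall>i\<in>Basis. \<exists>v. is_weak_deriv \<Omega> i u v}"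

definition sobolev_H2 :: "'a::euclidean_space set \<Rightarrow> 'a L2 set" where
  "sobolev_H2 \<Omega> = {u \<in> sobolev_H1 \<Omega>. \<forall>i\<in>Basis. weak_deriv \<Omega> i u \<in> sobolev_H1 \<Omega>}"

definition H1_norm :: "'a::euclidean_space set \<Rightarrow> 'a L2 \<Rightarrow> real" where
  "H1_norm \<Omega> u = sqrt ((norm u)\<^sup>2 + (\<Sum>i\<in>Basis. (norm (weak_deriv \<Omega> i u))\<^sup>2))"

definition sobolev_H1_0 :: "'a::euclidean_space set \<Rightarrow> 'a L2 set" where
  "sobolev_H1_0 \<Omega> =
     {u \<in> sobolev_H1 \<Omega>. \<forall>\<epsilon>>0. \<exists>\<phi>\<in>test_functions \<Omega>. H1_norm \<Omega> (u - L2_class \<phi>) < \<epsilon>}"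

definition dom_B :: "'a::euclidean_space set \<Rightarrow> 'a L2 set" where
  "dom_B \<Omega> = sobolev_H2 \<Omega> \<inter> sobolev_H1_0 \<Omega>"

definition op_B :: "'a::euclidean_space set \<Rightarrow> 'a L2 \<Rightarrow> 'a L2" where
  "op_B \<Omega> u = - (\<Sum>i\<in>Basis. weak_deriv \<Omega> i (weak_deriv \<Omega> i u))"

definition orthonormal_basis_of :: "'h::real_inner set \<Rightarrow> (nat \<Rightarrow> 'h) \<Rightarrow> bool" where
  "orthonormal_basis_of H e \<longleftrightarrow>
     (\<forall>j k. e j \<bullet> e k = (if j = k then 1 else 0)) \<and> closure (span (range e)) = H"

text \<open>Indices start at \<open>0\<close>, so \<open>lam 0\<close> is the first eigenvalue.\<close>

definition dirichlet_eigensystem ::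
    "'a::euclidean_space set \<Rightarrow> (nat \<Rightarrow> real) \<Rightarrow> (nat \<Rightarrow> 'a L2) \<Rightarrow> bool" where
  "dirichlet_eigensystem \<Omega> lam e \<longleftrightarrow>
     orthonormal_basis_of (L2_on \<Omega>) e \<and>
     (\<forall>j. e j \<in> dom_B \<Omega> \<and> op_B \<Omega> (e j) = lam j *\<^sub>R e j) \<and>
     0 < lam 0 \<and> incseq lam \<and> filterlim lam at_top sequentially"

section \<open>Operators diagonal in the eigenbasis\<close>

definition diag_dom ::
    "'a::euclidean_space set \<Rightarrow> (nat \<Rightarrow> 'a L2) \<Rightarrow> (nat \<Rightarrow> real) \<Rightarrow> 'a L2 set" where
  "diag_dom \<Omega> e c = {u \<in> L2_on \<Omega>. summable (\<lambda>j. (c j)\<^sup>2 * (u \<bullet> e j)\<^sup>2)}"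

definition diag_op ::
    "(nat \<Rightarrow> 'a::euclidean_space L2) \<Rightarrow> (nat \<Rightarrow> real) \<Rightarrow> 'a L2 \<Rightarrow> 'a L2" where
  "diag_op e c u = (\<Sum>j. (c j * (u \<bullet> e j)) *\<^sub>R e j)"

definition dom_PB where
  "dom_PB \<Omega> lam e P = diag_dom \<Omega> e (\<lambda>j. poly P (lam j))"

definition PB where
  "PB lam e P = diag_op e (\<lambda>j. poly P (lam j))"

text \<open>Minima of infinite sets of reals are written with \<open>LEAST\<close>.\<close>

definition mu_P :: "(nat \<Rightarrow> real) \<Rightarrow> real poly \<Rightarrow> real" where
  "mu_P lam P = (LEAST y. y \<in> poly P ` {lam 0..})"

definition dom_A_pow where
  "dom_A_pow \<Omega> lam e P \<kappa> \<theta> = diag_dom \<Omega> e (\<lambda>j. (poly P (lam j) + \<kappa>) powr \<theta>)"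

definition A_pow where
  "A_pow lam e P \<kappa> \<theta> = diag_op e (\<lambda>j. (poly P (lam j) + \<kappa>) powr \<theta>)"

section \<open>The projected flow on the unit sphere\<close>

definition unit_sphere :: "'a::euclidean_space set \<Rightarrow> 'a L2 set" where
  "unit_sphere \<Omega> = {u \<in> L2_on \<Omega>. norm u = 1}"

definition tangent_proj :: "'h::real_inner \<Rightarrow> 'h \<Rightarrow> 'h" where
  "tangent_proj u v = v - (v \<bullet> u) *\<^sub>R u"

text \<open>Continuity into the domain of \<open>P(B)\<close> with its graph norm is continuity of both \<open>u\<close>
  (already part of the first continuity requirement) and \<open>P(B) u\<close> in the norm of \<open>L\<^sup>2\<close>.\<close>

definition is_flow_solution ::
    "'a::euclidean_space set \<Rightarrow> (nat \<Rightarrow> real) \<Rightarrow> (nat \<Rightarrow> 'a L2) \<Rightarrow> real poly \<Rightarrow> 'a L2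
      \<Rightarrow> (real \<Rightarrow> 'a L2) \<Rightarrow> bool" where
  "is_flow_solution \<Omega> lam e P u0 u \<longleftrightarrow>
     (\<forall>t\<ge>0. u t \<in> unit_sphere \<Omega>) \<and>
     continuous_on {0..} u \<and>
     (\<forall>t>0. u t \<in> dom_PB \<Omega> lam e P) \<and>
     continuous_on {0<..} (\<lambda>t. PB lam e P (u t)) \<and>
     (\<exists>u'. continuous_on {0<..} u' \<and>
        (\<forall>t>0. (u has_vector_derivative u' t) (at t) \<and>
               u' t = - tangent_proj (u t) (PB lam e P (u t)))) \<and>
     u 0 = u0"

section \<open>Active spectrum\<close>

definition active_set ::
    "(nat \<Rightarrow> real) \<Rightarrow> (nat \<Rightarrow> 'a::euclidean_space L2) \<Rightarrow> real poly \<Rightarrow> 'a L2 \<Rightarrow> real set" where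
  "active_set lam e P u0 = {poly P (lam j) | j. u0 \<bullet> e j \<noteq> 0}"

definition mu_star where
  "mu_star lam e P u0 = (LEAST \<mu>. \<mu> \<in> active_set lam e P u0)"

definition H_star where
  "H_star \<Omega> lam e P u0 =
     {v \<in> dom_PB \<Omega> lam e P. PB lam e P v - mu_star lam e P u0 *\<^sub>R v = 0}"

definition orth_proj :: "'h::real_inner set \<Rightarrow> 'h \<Rightarrow> 'h" where
  "orth_proj S u = (THE v. v \<in> S \<and> (\<forall>w\<in>S. (u - v) \<bullet> w = 0))"

definition E_star where
  "E_star \<Omega> lam e P u0 = orth_proj (H_star \<Omega> lam e P u0)"

definition active_gap where
  "active_gap lam e P u0 =
     (LEAST d. d \<in> {\<mu> - mu_star lam e P u0 | \<mu>.
        \<mu> \<in> active_set lam e P u0 \<and> \<mu> > mu_star lam e P u0})"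

definition u_infinity where
  "u_infinity \<Omega> lam e P u0 = E_star \<Omega> lam e P u0 u0 /\<^sub>R norm (E_star \<Omega> lam e P u0 u0)"

definition C_theta where
  "C_theta \<Omega> lam e P \<kappa> \<theta> u0 =
     (let ws = E_star \<Omega> lam e P u0 u0; wp = u0 - ws; a = norm ws
      in norm (A_pow lam e P \<kappa> \<theta> wp) / a
         + norm (A_pow lam e P \<kappa> \<theta> ws) * (norm wp)\<^sup>2 / (2 * a ^ 3))"

end

theory Submission
  imports Defs
begin

text \<open>In the eigenbasis the flow decouples: writing \<open>u\<^sub>j = \<langle>u, e\<^sub>j\<rangle>\<close>, \<open>p\<^sub>j = P(\<lambda>\<^sub>j)\<close> and
  \<open>\<alpha> = \<langle>P(B)u, u\<rangle>\<close>, the equation becomes \<open>u\<^sub>j' = (\<alpha> - p\<^sub>j) u\<^sub>j\<close>.  All modes share the scalar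
  \<open>\<alpha>\<close>, so an integrating factor shows that \<open>u(t)\<close> is a positive multiple of \<open>\<Sum>\<^sub>j exp (- p\<^sub>j t) u\<^sub>0\<^sub>j e\<^sub>j\<close>
  (\<open>gauge_ode_solution\<close>, \<open>flow_coeff\<close>); this replaces any appeal to a uniqueness theorem for the
  flow.  Removing the smallest active value \<open>\<mu>\<close> from the exponents gives
  \<open>u(t) = (w\<^sub>* + r(t)) / D(t)\<close>, where \<open>w\<^sub>*\<close> is the projection of \<open>u\<^sub>0\<close> onto the lowest active
  eigenspace, \<open>r(t)\<close> is orthogonal to it and decays mode by mode like \<open>exp (- \<delta> t)\<close>, and
  \<open>D\<^sup>2 = \<parallel>w\<^sub>*\<parallel>\<^sup>2 + \<parallel>r\<parallel>\<^sup>2\<close> because \<open>u\<close> has norm one (\<open>flow_split\<close>).  As \<open>1/D\<close> differs from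
  \<open>1/\<parallel>w\<^sub>*\<parallel>\<close> only to second order in \<open>r\<close> (\<open>inverse_norm_gap\<close>), the distance to
  \<open>w\<^sub>* / \<parallel>w\<^sub>*\<parallel>\<close> decays with the rate of \<open>r\<close> and with the explicit constant (\<open>flow_decay\<close>).

  The computation commutes with every operator that is diagonal in the eigenbasis, so the norm of
  \<open>L\<^sup>2\<close> and all graph norms are treated at once.  For the series defining these operators
  to denote vectors, \<open>L\<^sup>2\<close> must be complete; this is the Riesz--Fischer theorem of the first section,
  after which vectors are handled through their coefficients (\<open>eqI_coeff\<close>, \<open>Parseval\<close>).\<close>

section \<open>Completeness of the space of square-integrable functions\<close>

lemma L2_class_exhaust:
  obtains f where "square_integrable f" "u = L2_class f"
proof -
  have "\<exists>f. square_integrable f \<and> u = L2_class f"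
    by transfer auto
  then show ?thesis using that by blast
qed

lemma norm_L2_class_diff:
  assumes "square_integrable f" "square_integrable g"
  shows "(norm (L2_class f - L2_class g))\<^sup>2 = (\<integral>x. (f x - g x)\<^sup>2 \<partial>lebesgue)"
proof -
  have "inner (L2_class f - L2_class g) (L2_class f - L2_class g)
      = (\<integral>x. (f x - g x) * (f x - g x) \<partial>lebesgue)"
    using assms by transfer simp
  then show ?thesis unfolding power2_norm_eq_inner by (simp add: power2_eq_square)
qed

text \<open>Along this subsequence consecutive distances are summable with a geometric rate, the form in
  which the Riesz--Fischer argument uses the Cauchy property.\<close>

lemma Cauchy_fast_subseq:
  fixes X :: "nat \<Rightarrow> 'a::metric_space"
  assumes "Cauchy X"
  obtains r where "strict_mono r" "\<And>k m n. r k \<le> m \<Longrightarrow> r k \<le> n \<Longrightarrow> dist (X m) (X n) < (1/2) ^ k"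
proof -
  have "\<forall>k. \<exists>N. \<forall>m\<ge>N. \<forall>n\<ge>N. dist (X m) (X n) < (1/2) ^ k"
    using assms unfolding Cauchy_def by auto
  then obtain N where N: "\<And>k m n. N k \<le> m \<Longrightarrow> N k \<le> n \<Longrightarrow> dist (X m) (X n) < (1/2) ^ k"
    by metis
  define r where "r k = k + (\<Sum>i\<le>k. N i)" for k
  have "strict_mono r" by (simp add: strict_mono_Suc_iff r_def)
  moreover have "N k \<le> r k" for k
    unfolding r_def by (simp add: member_le_sum trans_le_add2)
  ultimately show ?thesis using that N by (meson order_trans)
qed

text \<open>With geometric weights \<open>a = 2\<^sup>k\<close>, this turns summability of \<open>2\<^sup>k y\<^sub>k\<^sup>2\<close> into
  absolute summability of \<open>y\<^sub>k\<close>.\<close>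

lemma abs_le_weighted_square:
  fixes a y :: real
  assumes "a > 0"
  shows "\<bar>y\<bar> \<le> a * y\<^sup>2 + 1 / a"
proof -
  have "0 \<le> (a * \<bar>y\<bar> - 1)\<^sup>2 + a * \<bar>y\<bar>" using assms by simp
  also have "\<dots> = a * (a * y\<^sup>2 + 1 / a - \<bar>y\<bar>)"
    using assms by (simp add: power2_eq_square field_simps flip: abs_mult)
  finally show ?thesis using assms by (simp add: zero_le_mult_iff)
qed

text \<open>By monotone convergence \<open>\<Sum>\<^sub>k 2\<^sup>k g\<^sub>k\<^sup>2\<close> has integral at most
  \<open>\<Sum>\<^sub>k 2\<^sup>k 4\<^sup>-\<^sup>k = 2\<close>, so it is finite almost everywhere.  Weighting the squares avoids
  Minkowski's inequality for an infinite sum.\<close>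

lemma AE_summable_of_norm_bound:
  fixes g :: "nat \<Rightarrow> 'a::euclidean_space \<Rightarrow> real"
  assumes g: "\<And>k. square_integrable (g k)"
    and le: "\<And>k. (\<integral>x. (g k x)\<^sup>2 \<partial>lebesgue) \<le> (1/4) ^ k"
  shows "AE x in lebesgue. summable (\<lambda>k. g k x)"
proof -
  define h where "h k x = 2 ^ k * (g k x)\<^sup>2" for k x
  have m: "(\<lambda>x. ennreal (h k x)) \<in> borel_measurable lebesgue" for k
    using g[of k] by (auto simp: h_def square_integrable_def)
  have "(\<integral>\<^sup>+ x. ennreal (h k x) \<partial>lebesgue) \<le> ennreal ((1/2) ^ k)" for k
  proof -
    have "(\<integral>\<^sup>+ x. ennreal (h k x) \<partial>lebesgue) = ennreal (\<integral>x. h k x \<partial>lebesgue)"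
      using g[of k] by (intro nn_integral_eq_integral) (auto simp: h_def square_integrable_def)
    also have "\<dots> \<le> ennreal (2 ^ k * (1/4) ^ k)"
      unfolding h_def using le[of k] by (intro ennreal_leI) simp
    also have "(2::real) ^ k * (1/4) ^ k = (1/2) ^ k"
      by (simp flip: power_mult_distrib)
    finally show ?thesis .
  qed
  then have "(\<Sum>k. \<integral>\<^sup>+ x. ennreal (h k x) \<partial>lebesgue) \<le> (\<Sum>k. ennreal ((1/2) ^ k))"
    by (intro suminf_le) auto
  also have "\<dots> = ennreal (\<Sum>k. (1/2) ^ k)"
    by (intro suminf_ennreal2) auto
  also have "\<dots> < \<infinity>" by simp
  finally have "(\<integral>\<^sup>+ x. (\<Sum>k. ennreal (h k x)) \<partial>lebesgue) < \<infinity>"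
    using m by (subst nn_integral_suminf) auto
  then have "AE x in lebesgue. (\<Sum>k. ennreal (h k x)) \<noteq> \<infinity>"
    using m by (intro nn_integral_PInf_AE) auto
  then show ?thesis
  proof eventually_elim
    case (elim x)
    have sh: "summable (\<lambda>k. h k x)"
      using elim by (intro summable_suminf_not_top) (auto simp: h_def)
    have bound: "norm (g k x) \<le> h k x + (1/2) ^ k" for k
      using abs_le_weighted_square[of "2 ^ k" "g k x"] by (simp add: h_def power_one_over)
    have "summable (\<lambda>k. h k x + (1/2) ^ k)"
      using sh by (intro summable_add summable_geometric) auto
    then show ?case using bound by (rule summable_comparison_test')
  qed
qed

text \<open>Riesz--Fischer: a fast subsequence of representatives converges almost everywhere, and Fatou's
  lemma bounds the distance of its members to the pointwise limit.\<close>

instance L2 :: (euclidean_space) complete_space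
proof
  fix X :: "nat \<Rightarrow> 'a L2"
  assume X: "Cauchy X"
  obtain f where f: "\<And>n. square_integrable (f n)" "\<And>n. X n = L2_class (f n)"
  proof -
    have "\<forall>n. \<exists>f. square_integrable f \<and> X n = L2_class f"
      using L2_class_exhaust by blast
    from choice[OF this] show ?thesis using that by blast
  qed
  have [measurable]: "f n \<in> borel_measurable lebesgue" for n
    using f(1)[of n] by (simp add: square_integrable_def)
  obtain r where r: "strict_mono r"
    and Xr: "\<And>k m n. r k \<le> m \<Longrightarrow> r k \<le> n \<Longrightarrow> dist (X m) (X n) < (1/2) ^ k"
    using Cauchy_fast_subseq[OF X] by blast
  have close: "(\<integral>x. (f (r m) x - f (r k) x)\<^sup>2 \<partial>lebesgue) \<le> (1/4) ^ k" if "k \<le> m" for k m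
  proof -
    have "norm (X (r m) - X (r k)) \<le> (1/2) ^ k"
      using Xr[of k "r m" "r k"] that r by (auto simp: dist_norm strict_mono_less_eq)
    then have "(norm (X (r m) - X (r k)))\<^sup>2 \<le> ((1/2) ^ k)\<^sup>2"
      by (intro power_mono) auto
    also have "((1/2) ^ k)\<^sup>2 = ((1/4)::real) ^ k"
      by (simp add: power2_eq_square flip: power_mult_distrib)
    finally show ?thesis using f by (simp add: norm_L2_class_diff)
  qed
  \<comment> \<open>A default value of \<open>lim\<close> on the null set of divergence is harmless: \<open>F\<close> remains measurable.\<close>
  define F where "F x = lim (\<lambda>k. f (r k) x)" for x
  have [measurable]: "F \<in> borel_measurable lebesgue"
    unfolding F_def by measurable
  have "AE x in lebesgue. summable (\<lambda>k. f (r (Suc k)) x - f (r k) x)"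
    using f close by (intro AE_summable_of_norm_bound square_integrable_diff) auto
  then have lim: "AE x in lebesgue. (\<lambda>k. f (r k) x) \<longlonglongrightarrow> F x"
  proof eventually_elim
    case (elim x)
    then have "convergent (\<lambda>n. \<Sum>k<n. f (r (Suc k)) x - f (r k) x)"
      by (simp add: summable_iff_convergent)
    then have "convergent (\<lambda>n. f (r n) x - f (r 0) x)"
      by (simp add: sum_lessThan_telescope[where f = "\<lambda>k. f (r k) x"])
    then have "convergent (\<lambda>n. f (r n) x)"
      by (metis convergent_diff_const_right_iff)
    then show ?case by (simp add: F_def convergent_LIMSEQ_iff)
  qed
  have Fatou: "(\<integral>\<^sup>+ x. ennreal ((F x - f (r k) x)\<^sup>2) \<partial>lebesgue) \<le> ennreal ((1/4) ^ k)" for k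
  proof -
    have "(\<integral>\<^sup>+ x. ennreal ((F x - f (r k) x)\<^sup>2) \<partial>lebesgue)
        = (\<integral>\<^sup>+ x. liminf (\<lambda>m. ennreal ((f (r m) x - f (r k) x)\<^sup>2)) \<partial>lebesgue)"
    proof (rule nn_integral_cong_AE, use lim in eventually_elim)
      case (elim x)
      then have "(\<lambda>m. ennreal ((f (r m) x - f (r k) x)\<^sup>2)) \<longlonglongrightarrow> ennreal ((F x - f (r k) x)\<^sup>2)"
        by (intro tendsto_intros)
      then show ?case by (metis lim_imp_Liminf sequentially_bot)
    qed
    also have "\<dots> \<le> liminf (\<lambda>m. \<integral>\<^sup>+ x. ennreal ((f (r m) x - f (r k) x)\<^sup>2) \<partial>lebesgue)"
      by (rule nn_integral_liminf) measurable
    also have "\<dots> \<le> ennreal ((1/4) ^ k)"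
    proof -
      have "(\<integral>\<^sup>+ x. ennreal ((f (r m) x - f (r k) x)\<^sup>2) \<partial>lebesgue) \<le> ennreal ((1/4) ^ k)"
        if "k \<le> m" for m
      proof -
        have "(\<integral>\<^sup>+ x. ennreal ((f (r m) x - f (r k) x)\<^sup>2) \<partial>lebesgue)
            = ennreal (\<integral>x. (f (r m) x - f (r k) x)\<^sup>2 \<partial>lebesgue)"
          using square_integrable_diff[OF f(1) f(1)]
          by (intro nn_integral_eq_integral) (auto simp: square_integrable_def)
        then show ?thesis
          using close[OF that] by (simp add: ennreal_leI)
      qed
      then have "liminf (\<lambda>m. \<integral>\<^sup>+ x. ennreal ((f (r m) x - f (r k) x)\<^sup>2) \<partial>lebesgue)
          \<le> liminf (\<lambda>m. ennreal ((1/4) ^ k))"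
        by (intro Liminf_mono eventually_mono[OF eventually_ge_at_top[of k]]) blast
      then show ?thesis by (simp add: Liminf_const)
    qed
    finally show ?thesis .
  qed
  have sqd: "square_integrable (\<lambda>x. F x - f (r k) x)" for k
    unfolding square_integrable_def
  proof
    show "integrable lebesgue (\<lambda>x. (F x - f (r k) x)\<^sup>2)"
      using Fatou[of k] by (intro integrableI_bounded) (auto simp: le_less_trans)
  qed simp
  have sqF: "square_integrable F"
    using square_integrable_add[OF sqd[of 0] f(1)[of "r 0"]] by simp
  have bound: "(norm (X (r k) - L2_class F))\<^sup>2 \<le> (1/4) ^ k" for k
  proof -
    have "ennreal (\<integral>x. (F x - f (r k) x)\<^sup>2 \<partial>lebesgue) \<le> ennreal ((1/4) ^ k)"
      using Fatou[of k] sqd[of k] by (subst nn_integral_eq_integral[symmetric]) (auto simp: square_integrable_def)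
    then show ?thesis
      using f sqF by (simp add: norm_L2_class_diff norm_minus_commute)
  qed
  have "(\<lambda>k. (norm (X (r k) - L2_class F))\<^sup>2) \<longlonglongrightarrow> 0"
    by (rule real_tendsto_sandwich[OF _ _ tendsto_const LIMSEQ_power_zero[of "1/4"]])
       (auto simp: bound)
  then have "(\<lambda>k. sqrt ((norm (X (r k) - L2_class F))\<^sup>2)) \<longlonglongrightarrow> sqrt 0"
    by (rule tendsto_real_sqrt)
  then have "(X \<circ> r) \<longlonglongrightarrow> L2_class F"
    by (simp add: tendsto_norm_zero_iff LIM_zero_iff o_def)
  then show "convergent X"
    using Cauchy_converges_subseq[OF X r(1)] by (auto simp: convergent_def)
qed

section \<open>Expansion in an orthonormal basis\<close>

lemma subspace_closure_real_normed:
  fixes S :: "'h::real_normed_vector set"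
  assumes S: "subspace S"
  shows "subspace (closure S)"
proof (rule subspaceI)
  show "0 \<in> closure S" using subspace_0[OF S] closure_subset by blast
next
  fix x y assume "x \<in> closure S" "y \<in> closure S"
  then obtain f g where f: "\<forall>n. f n \<in> S" "f \<longlonglongrightarrow> x" and g: "\<forall>n. g n \<in> S" "g \<longlonglongrightarrow> y"
    unfolding closure_sequential by metis
  have "\<forall>n. f n + g n \<in> S" using f(1) g(1) subspace_add[OF S] by simp
  with tendsto_add[OF f(2) g(2)] show "x + y \<in> closure S"
    unfolding closure_sequential by (intro exI[of _ "\<lambda>n. f n + g n"] conjI)
next
  fix c x assume "x \<in> closure S"
  then obtain f where f: "\<forall>n. f n \<in> S" "f \<longlonglongrightarrow> x"
    unfolding closure_sequential by metis
  have "\<forall>n. c *\<^sub>R f n \<in> S" using f(1) subspace_scale[OF S] by simp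
  with tendsto_scaleR[OF tendsto_const f(2)] show "c *\<^sub>R x \<in> closure S"
    unfolding closure_sequential by (intro exI[of _ "\<lambda>n. c *\<^sub>R f n"] conjI)
qed

text \<open>Completeness of the ambient type is what turns square-summable coefficients into vectors.\<close>

locale orthonormal_basis =
  fixes H :: "'h::{real_inner, complete_space} set" and e :: "nat \<Rightarrow> 'h"
  assumes onb: "orthonormal_basis_of H e"
begin

lemma inner_basis: "e j \<bullet> e k = (if j = k then 1 else 0)"
  using onb by (simp add: orthonormal_basis_of_def)

lemma subspace_H: "subspace H"
  using onb subspace_closure_real_normed[OF subspace_span[of "range e"]]
  by (simp add: orthonormal_basis_of_def)

lemma closed_H: "closed H"
  using onb by (auto simp: orthonormal_basis_of_def)

lemma basis_mem: "e j \<in> H"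
  using onb closure_subset[of "span (range e)"] span_base[of "e j" "range e"]
  by (auto simp: orthonormal_basis_of_def)

lemma norm_finite_series:
  assumes "finite F"
  shows "(norm (\<Sum>j\<in>F. c j *\<^sub>R e j))\<^sup>2 = (\<Sum>j\<in>F. (c j)\<^sup>2)"
proof -
  have "(norm (\<Sum>j\<in>F. c j *\<^sub>R e j))\<^sup>2 = (\<Sum>j\<in>F. \<Sum>k\<in>F. (c j *\<^sub>R e j) \<bullet> (c k *\<^sub>R e k))"
    by (simp only: power2_norm_eq_inner inner_sum_left) (simp only: inner_sum_right)
  also have "\<dots> = (\<Sum>j\<in>F. \<Sum>k\<in>F. if j = k then (c j)\<^sup>2 else 0)"
    by (intro sum.cong) (auto simp: inner_basis power2_eq_square)
  also have "\<dots> = (\<Sum>j\<in>F. (c j)\<^sup>2)"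
    using assms by simp
  finally show ?thesis .
qed

lemma summable_series:
  assumes "summable (\<lambda>j. (c j)\<^sup>2)"
  shows "summable (\<lambda>j. c j *\<^sub>R e j)"
proof -
  have "Cauchy (\<lambda>n. \<Sum>j<n. c j *\<^sub>R e j)"
  proof (rule metric_CauchyI)
    fix \<epsilon> :: real assume "\<epsilon> > 0"
    then have "\<epsilon>\<^sup>2 > 0" by simp
    with assms obtain N where N: "\<And>m n. m \<ge> N \<Longrightarrow> norm (\<Sum>j=m..<n. (c j)\<^sup>2) < \<epsilon>\<^sup>2"
      unfolding summable_Cauchy by blast
    have one: "dist (\<Sum>j<m. c j *\<^sub>R e j) (\<Sum>j<n. c j *\<^sub>R e j) < \<epsilon>" if "N \<le> m" "m \<le> n" for m n
    proof -
      have "{..<n} = {..<m} \<union> {m..<n}" using that by auto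
      then have "(\<Sum>j<n. c j *\<^sub>R e j) - (\<Sum>j<m. c j *\<^sub>R e j) = (\<Sum>j=m..<n. c j *\<^sub>R e j)"
        by (simp add: sum.union_disjoint[OF _ _ ivl_disj_int_one(2)])
      then have "(dist (\<Sum>j<m. c j *\<^sub>R e j) (\<Sum>j<n. c j *\<^sub>R e j))\<^sup>2 = (\<Sum>j=m..<n. (c j)\<^sup>2)"
        by (subst dist_commute) (simp add: dist_norm norm_finite_series)
      also have "\<dots> < \<epsilon>\<^sup>2" using N[OF that(1), of n] by simp
      finally show ?thesis by (rule power2_less_imp_less) (use \<open>\<epsilon> > 0\<close> in simp)
    qed
    show "\<exists>M. \<forall>m\<ge>M. \<forall>n\<ge>M. dist (\<Sum>j<m. c j *\<^sub>R e j) (\<Sum>j<n. c j *\<^sub>R e j) < \<epsilon>"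
    proof (intro exI[of _ N] allI impI)
      fix m n assume "N \<le> m" "N \<le> n"
      then show "dist (\<Sum>j<m. c j *\<^sub>R e j) (\<Sum>j<n. c j *\<^sub>R e j) < \<epsilon>"
        using one[of m n] one[of n m] by (cases "m \<le> n") (auto simp: dist_commute)
    qed
  qed
  then show ?thesis
    by (simp add: summable_iff_convergent Cauchy_convergent_iff)
qed

lemma inner_series:
  assumes "summable (\<lambda>j. (c j)\<^sup>2)"
  shows "(\<Sum>j. c j *\<^sub>R e j) \<bullet> e k = c k"
proof -
  have "(\<lambda>j. (c j *\<^sub>R e j) \<bullet> e k) sums ((\<Sum>j. c j *\<^sub>R e j) \<bullet> e k)"
    using summable_sums[OF summable_series[OF assms]]
    by (rule bounded_linear.sums[OF bounded_linear_inner_left])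
  moreover have "(\<lambda>j. (c j *\<^sub>R e j) \<bullet> e k) = (\<lambda>j. if j = k then c j else 0)"
    by (auto simp: inner_basis)
  ultimately show ?thesis
    using sums_single[of k c] by (simp add: sums_unique2)
qed

lemma series_mem:
  assumes "summable (\<lambda>j. (c j)\<^sup>2)"
  shows "(\<Sum>j. c j *\<^sub>R e j) \<in> H"
proof (rule closed_sequentially[OF closed_H])
  show "(\<lambda>n. \<Sum>j<n. c j *\<^sub>R e j) \<longlonglongrightarrow> (\<Sum>j. c j *\<^sub>R e j)"
    using summable_sums[OF summable_series[OF assms]] by (simp add: sums_def)
  show "(\<Sum>j<n. c j *\<^sub>R e j) \<in> H" for n
    by (intro subspace_sum subspace_scale subspace_H basis_mem)
qed

lemma Bessel: "summable (\<lambda>j. (u \<bullet> e j)\<^sup>2)"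
proof (rule summableI_nonneg_bounded)
  fix n
  let ?s = "\<Sum>j<n. (u \<bullet> e j) *\<^sub>R e j"
  have "u \<bullet> ?s = (\<Sum>j<n. (u \<bullet> e j)\<^sup>2)"
    by (simp add: inner_sum_right power2_eq_square)
  moreover have "?s \<bullet> ?s = (\<Sum>j<n. (u \<bullet> e j)\<^sup>2)"
    by (simp add: norm_finite_series flip: power2_norm_eq_inner)
  ultimately have "0 \<le> (norm u)\<^sup>2 - (\<Sum>j<n. (u \<bullet> e j)\<^sup>2)"
    using inner_ge_zero[of "u - ?s"]
    by (simp add: inner_diff_left inner_diff_right inner_commute power2_norm_eq_inner)
  then show "(\<Sum>j<n. (u \<bullet> e j)\<^sup>2) \<le> (norm u)\<^sup>2" by simp
qed simp

text \<open>A vector of \<open>H\<close> orthogonal to every \<open>e j\<close> is orthogonal to the closed span, that is, to itself.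
  Every identity between vectors of \<open>H\<close> below is reduced to coefficients in this way.\<close>

lemma eqI_coeff:
  assumes "u \<in> H" "v \<in> H" and coeff: "\<And>j. u \<bullet> e j = v \<bullet> e j"
  shows "u = v"
proof -
  have "u - v \<in> closure (span (range e))"
    using onb subspace_diff[OF subspace_H assms(1,2)] by (simp add: orthonormal_basis_of_def)
  moreover have "closure (span (range e)) \<subseteq> {w. (u - v) \<bullet> w = 0}"
  proof (rule closure_minimal)
    have "orthogonal (u - v) w" if "w \<in> span (range e)" for w
      by (rule orthogonal_to_span[OF that])
         (auto simp: orthogonal_def inner_diff_left coeff)
    then show "span (range e) \<subseteq> {w. (u - v) \<bullet> w = 0}" by (auto simp: orthogonal_def)
    show "closed {w. (u - v) \<bullet> w = 0}"
      by (intro closed_Collect_eq continuous_intros)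
  qed
  ultimately have "(u - v) \<bullet> (u - v) = 0" by blast
  then show ?thesis by simp
qed

lemma inner_sums:
  assumes "u \<in> H"
  shows "(\<lambda>j. (u \<bullet> e j) * (v \<bullet> e j)) sums (u \<bullet> v)"
proof -
  have "(\<Sum>j. (u \<bullet> e j) *\<^sub>R e j) = u"
    using assms Bessel[of u] by (intro eqI_coeff) (auto simp: inner_series series_mem)
  then have "(\<lambda>j. (u \<bullet> e j) *\<^sub>R e j) sums u"
    using summable_sums[OF summable_series[OF Bessel[of u]]] by simp
  then have "(\<lambda>j. ((u \<bullet> e j) *\<^sub>R e j) \<bullet> v) sums (u \<bullet> v)"
    by (rule bounded_linear.sums[OF bounded_linear_inner_left])
  then show ?thesis by (simp add: inner_commute)
qed

lemma Parseval: "u \<in> H \<Longrightarrow> (\<lambda>j. (u \<bullet> e j)\<^sup>2) sums (norm u)\<^sup>2"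
  using inner_sums[of u u] by (simp add: power2_eq_square flip: power2_norm_eq_inner)

text \<open>Comparison of coefficients; this is how exponential decay of each mode, with a common rate,
  becomes decay in norm.\<close>

lemma norm_le_coeff:
  assumes "u \<in> H" "v \<in> H" "K \<ge> 0" and le: "\<And>j. \<bar>u \<bullet> e j\<bar> \<le> K * \<bar>v \<bullet> e j\<bar>"
  shows "norm u \<le> K * norm v"
proof -
  have "(u \<bullet> e j)\<^sup>2 \<le> K\<^sup>2 * (v \<bullet> e j)\<^sup>2" for j
    using power_mono[OF le[of j], of 2] by (simp add: power_mult_distrib)
  then have "(norm u)\<^sup>2 \<le> K\<^sup>2 * (norm v)\<^sup>2"
    by (rule sums_le[OF _ Parseval[OF assms(1)] sums_mult[OF Parseval[OF assms(2)]]])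
  then have "(norm u)\<^sup>2 \<le> (K * norm v)\<^sup>2" by (simp add: power_mult_distrib)
  then show ?thesis by (rule power2_le_imp_le) (use \<open>K \<ge> 0\<close> in simp)
qed

end

section \<open>Diagonal operators\<close>

locale L2_orthonormal_basis = orthonormal_basis "L2_on \<Omega>" e
  for \<Omega> :: "'a::euclidean_space set" and e :: "nat \<Rightarrow> 'a L2"
begin

lemma diag_dom_iff:
  "u \<in> diag_dom \<Omega> e c \<longleftrightarrow> u \<in> L2_on \<Omega> \<and> summable (\<lambda>j. (c j * (u \<bullet> e j))\<^sup>2)"
  by (simp add: diag_dom_def power_mult_distrib)

lemma diag_dom_mem: "u \<in> diag_dom \<Omega> e c \<Longrightarrow> u \<in> L2_on \<Omega>"
  by (simp add: diag_dom_iff)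

lemma diag_op_coeff: "u \<in> diag_dom \<Omega> e c \<Longrightarrow> diag_op e c u \<bullet> e k = c k * (u \<bullet> e k)"
  by (simp add: diag_dom_iff diag_op_def inner_series)

lemma diag_op_mem: "u \<in> diag_dom \<Omega> e c \<Longrightarrow> diag_op e c u \<in> L2_on \<Omega>"
  by (simp add: diag_dom_iff diag_op_def series_mem)

text \<open>The coefficients whose squares must be summable are those of the vector
  \<open>a *\<^sub>R diag_op e c u + b *\<^sub>R diag_op e c v\<close>, so Bessel's inequality gives the summability.\<close>

lemma diag_dom_lincomb:
  assumes u: "u \<in> diag_dom \<Omega> e c" and v: "v \<in> diag_dom \<Omega> e c"
  shows "a *\<^sub>R u + b *\<^sub>R v \<in> diag_dom \<Omega> e c"
proof -
  have "summable (\<lambda>j. ((a *\<^sub>R diag_op e c u + b *\<^sub>R diag_op e c v) \<bullet> e j)\<^sup>2)"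
    by (rule Bessel)
  then have "summable (\<lambda>j. (c j * ((a *\<^sub>R u + b *\<^sub>R v) \<bullet> e j))\<^sup>2)"
    using u v by (simp add: inner_add_left diag_op_coeff algebra_simps)
  moreover have "a *\<^sub>R u + b *\<^sub>R v \<in> L2_on \<Omega>"
    using u v by (intro subspace_add subspace_scale subspace_H diag_dom_mem)
  ultimately show ?thesis by (simp add: diag_dom_iff)
qed

lemma diag_op_lincomb:
  assumes u: "u \<in> diag_dom \<Omega> e c" and v: "v \<in> diag_dom \<Omega> e c"
  shows "diag_op e c (a *\<^sub>R u + b *\<^sub>R v) = a *\<^sub>R diag_op e c u + b *\<^sub>R diag_op e c v"
proof (rule eqI_coeff)
  show "diag_op e c (a *\<^sub>R u + b *\<^sub>R v) \<in> L2_on \<Omega>"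
    by (intro diag_op_mem diag_dom_lincomb u v)
  show "a *\<^sub>R diag_op e c u + b *\<^sub>R diag_op e c v \<in> L2_on \<Omega>"
    by (intro subspace_add subspace_scale subspace_H diag_op_mem u v)
qed (use u v in \<open>simp add: diag_op_coeff[OF diag_dom_lincomb] diag_op_coeff inner_add_left algebra_simps\<close>)

lemma diag_dom_dominated:
  assumes v: "v \<in> diag_dom \<Omega> e c" and u: "u \<in> L2_on \<Omega>" and K: "K \<ge> 0"
    and le: "\<And>j. \<bar>u \<bullet> e j\<bar> \<le> K * \<bar>v \<bullet> e j\<bar>"
  shows "u \<in> diag_dom \<Omega> e c" "norm (diag_op e c u) \<le> K * norm (diag_op e c v)"
proof -
  have le': "\<bar>c j * (u \<bullet> e j)\<bar> \<le> K * \<bar>c j * (v \<bullet> e j)\<bar>" for j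
    using mult_left_mono[OF le[of j], of "\<bar>c j\<bar>"] by (simp add: abs_mult ac_simps)
  have sq_le: "norm ((c j * (u \<bullet> e j))\<^sup>2) \<le> K\<^sup>2 * (c j * (v \<bullet> e j))\<^sup>2" for j
    using power_mono[OF le'[of j], of 2] by (simp add: power_mult_distrib)
  have "summable (\<lambda>j. K\<^sup>2 * (c j * (v \<bullet> e j))\<^sup>2)"
    using v by (intro summable_mult) (simp add: diag_dom_iff)
  then have "summable (\<lambda>j. (c j * (u \<bullet> e j))\<^sup>2)"
    by (rule summable_comparison_test'[where N = 0]) (rule sq_le)
  then show dom: "u \<in> diag_dom \<Omega> e c" using u by (simp add: diag_dom_iff)
  show "norm (diag_op e c u) \<le> K * norm (diag_op e c v)"
  proof (rule norm_le_coeff[OF diag_op_mem[OF dom] diag_op_mem[OF v] K])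
    show "\<bar>diag_op e c u \<bullet> e j\<bar> \<le> K * \<bar>diag_op e c v \<bullet> e j\<bar>" for j
      using le'[of j] by (simp only: diag_op_coeff[OF dom] diag_op_coeff[OF v])
  qed
qed

lemma diag_dom_one: "diag_dom \<Omega> e (\<lambda>_. 1) = L2_on \<Omega>"
  by (auto simp: diag_dom_iff Bessel)

lemma diag_op_one: "u \<in> L2_on \<Omega> \<Longrightarrow> diag_op e (\<lambda>_. 1) u = u"
  by (rule eqI_coeff) (auto simp: diag_op_coeff diag_op_mem diag_dom_one)

end

section \<open>Linear modes driven by a common scalar\<close>

text \<open>The common factor \<open>\<alpha>\<close> acts on all modes alike, so with \<open>F' = \<alpha>\<close> each
  \<open>x j t * exp (p j * t - F t)\<close> is constant for \<open>t > 0\<close>.  The factor \<open>\<alpha>\<close> may be singular at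
  \<open>0\<close>; that \<open>exp (F t)\<close> nevertheless has a finite positive limit there is read off from one mode
  that is continuous and nonzero at \<open>0\<close>.\<close>

lemma gauge_ode_solution:
  fixes x :: "'i \<Rightarrow> real \<Rightarrow> real" and p :: "'i \<Rightarrow> real" and \<alpha> :: "real \<Rightarrow> real"
  assumes ode: "\<And>j t. t > 0 \<Longrightarrow> (x j has_real_derivative (\<alpha> t - p j) * x j t) (at t)"
    and cont: "\<And>j. continuous_on {0..} (x j)"
    and cont_\<alpha>: "continuous_on {0<..} \<alpha>"
    and nz: "x k 0 \<noteq> 0"
  obtains \<phi> where "\<And>t. t \<ge> 0 \<Longrightarrow> \<phi> t > 0" "\<And>j t. t \<ge> 0 \<Longrightarrow> x j t = x j 0 * exp (- p j * t) * \<phi> t"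
proof -
  have "isCont \<alpha> t" if "t > 0" for t
    using cont_\<alpha> that by (simp add: continuous_on_eq_continuous_at)
  then obtain F where F: "\<And>t. t > 0 \<Longrightarrow> (F has_real_derivative \<alpha> t) (at t)"
    using einterval_antiderivative[of 0 \<infinity> \<alpha>]
    by (auto simp: has_real_derivative_iff_has_vector_derivative zero_ereal_def)
  have "\<exists>c. \<forall>t\<in>{0<..}. x j t * exp (p j * t - F t) = c" for j
  proof (rule has_field_derivative_zero_constant)
    show "convex {0::real<..}" by simp
    fix t :: real assume t: "t \<in> {0<..}"
    have "((\<lambda>t. exp (p j * t - F t)) has_real_derivative exp (p j * t - F t) * (p j - \<alpha> t)) (at t)"
      using F[of t] t by (auto intro!: derivative_eq_intros)
    from DERIV_mult[OF ode[of t j] this] t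
    have "((\<lambda>t. x j t * exp (p j * t - F t)) has_real_derivative 0) (at t)"
      by (simp add: algebra_simps)
    then show "((\<lambda>t. x j t * exp (p j * t - F t)) has_real_derivative 0) (at t within {0<..})"
      by (rule has_field_derivative_at_within)
  qed
  then have "\<forall>j. \<exists>c. \<forall>t\<in>{0<..}. x j t * exp (p j * t - F t) = c" ..
  from choice[OF this] obtain c where c: "\<And>j t. t > 0 \<Longrightarrow> x j t * exp (p j * t - F t) = c j"
    by auto
  have x_eq: "x j t = c j * exp (- p j * t) * exp (F t)" if "t > 0" for j t
  proof -
    have "exp (p j * t - F t) * (exp (- p j * t) * exp (F t)) = 1"
      by (simp flip: exp_add)
    then show ?thesis unfolding c[OF that, of j, symmetric] by (simp add: mult.assoc)
  qed
  have lim0: "(x j \<longlongrightarrow> x j 0) (at_right 0)" for j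
    using cont[of j] by (auto simp: continuous_on intro: tendsto_within_subset)
  have pos: "\<forall>\<^sub>F t :: real in at_right 0. t > 0" by (rule eventually_at_right_less)
  \<comment> \<open>Otherwise mode \<open>k\<close> would vanish for all positive times and, by continuity, at time \<open>0\<close>.\<close>
  have ck: "c k \<noteq> 0"
  proof
    assume "c k = 0"
    then have "(x k \<longlongrightarrow> 0) (at_right 0)"
      by (intro tendsto_eventually eventually_mono[OF pos]) (simp add: x_eq)
    then show False using nz tendsto_unique[OF trivial_limit_at_right_real lim0[of k]] by auto
  qed
  define L where "L = x k 0 / c k"
  have "((\<lambda>t. x k t * exp (p k * t) / c k) \<longlongrightarrow> x k 0 * exp (p k * 0) / c k) (at_right 0)"
    using ck by (intro tendsto_intros lim0)
  moreover have "\<forall>\<^sub>F t in at_right 0. x k t * exp (p k * t) / c k = exp (F t)"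
    using pos by eventually_elim (use ck in \<open>simp add: x_eq exp_minus field_simps\<close>)
  ultimately have limF: "((\<lambda>t. exp (F t)) \<longlongrightarrow> L) (at_right 0)"
    unfolding L_def by (simp add: Lim_transform_eventually)
  have "L \<ge> 0"
    by (rule tendsto_lowerbound[OF limF]) auto
  then have "L > 0" using nz ck by (simp add: L_def less_le)
  have x0: "x j 0 = c j * L" for j
  proof -
    have "((\<lambda>t. c j * exp (- p j * t) * exp (F t)) \<longlongrightarrow> c j * exp (- p j * 0) * L) (at_right 0)"
      by (intro tendsto_intros limF)
    then have "(x j \<longlongrightarrow> c j * exp (- p j * 0) * L) (at_right 0)"
      by (rule Lim_transform_eventually) (use pos in \<open>eventually_elim, simp add: x_eq\<close>)
    then show ?thesis using tendsto_unique[OF trivial_limit_at_right_real lim0[of j]] by simp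
  qed
  show ?thesis
  proof (rule that[of "\<lambda>t. if t = 0 then 1 else exp (F t) / L"])
    fix t :: real assume "t \<ge> 0"
    show "(if t = 0 then 1 else exp (F t) / L) > 0" using \<open>L > 0\<close> by simp
    show "x j t = x j 0 * exp (- p j * t) * (if t = 0 then 1 else exp (F t) / L)" for j
      using \<open>L > 0\<close> \<open>t \<ge> 0\<close> x_eq[of t j] x0[of j] by (cases "t = 0") auto
  qed
qed

section \<open>Minima of spectral sets and the normalising factor\<close>

text \<open>Only finitely many members of a sequence tending to infinity lie below a given bound, so a
  nonempty set of its values has a true minimum and \<open>LEAST\<close> picks it.\<close>

lemma Least_unbounded_sequence:
  fixes p :: "nat \<Rightarrow> real"
  assumes "filterlim p at_top sequentially" "S \<subseteq> range p" "S \<noteq> {}"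
  shows "(LEAST s. s \<in> S) \<in> S" "\<And>s. s \<in> S \<Longrightarrow> (LEAST s. s \<in> S) \<le> s"
proof -
  obtain s0 where s0: "s0 \<in> S" using assms(3) by blast
  obtain N where N: "\<And>j. j \<ge> N \<Longrightarrow> s0 < p j"
    using assms(1) by (auto simp: filterlim_at_top_dense eventually_sequentially)
  let ?T = "{s \<in> S. s \<le> s0}"
  have "?T \<subseteq> p ` {..<N}"
  proof
    fix s assume "s \<in> ?T"
    then obtain j where "s = p j" "p j \<le> s0" using assms(2) by auto
    then show "s \<in> p ` {..<N}" using N[of j] by (cases "j < N") auto
  qed
  then have fin: "finite ?T" by (rule finite_subset) simp
  have mem: "Min ?T \<in> ?T" using s0 by (intro Min_in fin) auto
  have min: "Min ?T \<le> s" if "s \<in> S" for s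
    using that mem Min_le[OF fin, of s] by (cases "s \<le> s0") auto
  have eq: "(LEAST s. s \<in> S) = Min ?T"
    using mem by (intro Least_equality min) auto
  show "(LEAST s. s \<in> S) \<in> S" using mem unfolding eq by blast
  show "(LEAST s. s \<in> S) \<le> s" if "s \<in> S" for s using min[OF that] unfolding eq .
qed

lemma poly_at_top:
  fixes P :: "real poly"
  assumes "degree P \<ge> 1" "lead_coeff P > 0"
  shows "filterlim (poly P) at_top at_top"
proof (cases P)
  case (pCons a Q)
  then have "Q \<noteq> 0" using assms(1) by auto
  then have lead: "lead_coeff Q > 0" using assms(2) pCons by simp
  obtain n where n: "\<And>x. x \<ge> n \<Longrightarrow> lead_coeff Q \<le> poly Q x"
    using poly_pinfty_gt_lc[OF lead] by blast
  have "filterlim (\<lambda>x. a + lead_coeff Q * x) at_top at_top"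
    by (intro filterlim_tendsto_add_at_top[OF tendsto_const]
        filterlim_tendsto_pos_mult_at_top[OF tendsto_const lead] filterlim_ident)
  then show ?thesis
  proof (rule filterlim_at_top_mono)
    show "\<forall>\<^sub>F x in at_top. a + lead_coeff Q * x \<le> poly P x"
      using eventually_ge_at_top[of "max 0 n"]
      by eventually_elim (use n in \<open>auto simp: pCons mult.commute intro!: mult_left_mono\<close>)
  qed
qed

text \<open>Since \<open>P\<close> tends to infinity its minimum over the half-line is attained, on a compact interval;
  only then is the \<open>LEAST\<close> in \<open>mu_P\<close> meaningful.\<close>

lemma mu_P_le:
  assumes P: "degree P \<ge> 1" "lead_coeff P > 0" and s: "lam 0 \<le> s"
  shows "mu_P lam P \<le> poly P s"
proof -
  obtain R where R: "\<And>x. x \<ge> R \<Longrightarrow> poly P (lam 0) \<le> poly P x"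
    using poly_at_top[OF P] unfolding filterlim_at_top eventually_at_top_linorder by blast
  have "\<exists>m\<in>{lam 0..max (lam 0) R}. \<forall>x\<in>{lam 0..max (lam 0) R}. poly P m \<le> poly P x"
    by (intro continuous_attains_inf continuous_intros) auto
  then obtain m where m: "m \<in> {lam 0..max (lam 0) R}"
    "\<And>x. x \<in> {lam 0..max (lam 0) R} \<Longrightarrow> poly P m \<le> poly P x"
    by blast
  have le: "poly P m \<le> poly P x" if "x \<ge> lam 0" for x
  proof (cases "x \<le> max (lam 0) R")
    case True
    then show ?thesis using m(2) that by simp
  next
    case False
    then have "poly P (lam 0) \<le> poly P x" by (intro R) simp
    moreover have "poly P m \<le> poly P (lam 0)" by (intro m(2)) simp
    ultimately show ?thesis by linarith
  qed
  have "mu_P lam P = poly P m"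
    unfolding mu_P_def using le m(1) by (intro Least_equality) auto
  then show ?thesis using le[OF s] by simp
qed

text \<open>The normalising factor \<open>1 / D\<close> differs from its limit \<open>1 / a\<close> by a term quadratic in the
  remainder \<open>R\<close>; the second summand of the decay constant comes from here.\<close>

lemma inverse_norm_gap:
  fixes a D R :: real
  assumes "a > 0" "D \<ge> 0" and D: "D\<^sup>2 = a\<^sup>2 + R\<^sup>2"
  shows "a \<le> D" "\<bar>1 / D - 1 / a\<bar> \<le> R\<^sup>2 / (2 * a ^ 3)"
proof -
  show aD: "a \<le> D" by (rule power2_le_imp_le) (use assms in auto)
  then have "D > 0" using \<open>a > 0\<close> by linarith
  have "(D - a) * (D + a) = R\<^sup>2" using D by (simp add: power2_eq_square algebra_simps)
  then have "D - a = R\<^sup>2 / (D + a)" using \<open>D > 0\<close> \<open>a > 0\<close> by (simp add: field_simps)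
  moreover have "\<bar>1 / D - 1 / a\<bar> = (D - a) / (a * D)"
  proof -
    have "1 / D - 1 / a = - ((D - a) / (a * D))"
      using \<open>D > 0\<close> \<open>a > 0\<close> by (simp add: field_simps)
    moreover have "0 \<le> (D - a) / (a * D)" using aD \<open>D > 0\<close> \<open>a > 0\<close> by simp
    ultimately show ?thesis by linarith
  qed
  ultimately have "\<bar>1 / D - 1 / a\<bar> = R\<^sup>2 / (a * D * (D + a))"
    by (simp add: mult.commute)
  also have "\<dots> \<le> R\<^sup>2 / (a * a * (a + a))"
    using aD \<open>D > 0\<close> \<open>a > 0\<close> by (intro divide_left_mono mult_mono mult_pos_pos) auto
  also have "a * a * (a + a) = 2 * a ^ 3" by (simp add: power3_eq_cube algebra_simps)
  finally show "\<bar>1 / D - 1 / a\<bar> \<le> R\<^sup>2 / (2 * a ^ 3)" .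
qed

section \<open>Asymptotics of the normalized flow\<close>

text \<open>Divergence of \<open>P(\<lambda>\<^sub>j)\<close> is what makes the active values discrete: it provides the lowest
  one and, when there are others, the positive distance to the next.\<close>

locale normalized_flow = L2_orthonormal_basis \<Omega> e
  for \<Omega> :: "'a::euclidean_space set" and e :: "nat \<Rightarrow> 'a L2" +
  fixes lam :: "nat \<Rightarrow> real" and P :: "real poly" and u0 :: "'a L2" and u :: "real \<Rightarrow> 'a L2"
  assumes unbounded: "filterlim (\<lambda>j. poly P (lam j)) at_top sequentially"
    and sol: "is_flow_solution \<Omega> lam e P u0 u"
begin

abbreviation p :: "nat \<Rightarrow> real" where "p j \<equiv> poly P (lam j)"
abbreviation \<mu> :: real where "\<mu> \<equiv> mu_star lam e P u0"
abbreviation ws :: "'a L2" where "ws \<equiv> E_star \<Omega> lam e P u0 u0"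
abbreviation wp :: "'a L2" where "wp \<equiv> u0 - ws"
abbreviation uinf :: "'a L2" where "uinf \<equiv> u_infinity \<Omega> lam e P u0"

lemma flow_mem: "t \<ge> 0 \<Longrightarrow> u t \<in> L2_on \<Omega>" and flow_norm: "t \<ge> 0 \<Longrightarrow> norm (u t) = 1"
  using sol by (auto simp: is_flow_solution_def unit_sphere_def)

lemma flow_0: "u 0 = u0"
  using sol by (simp add: is_flow_solution_def)

lemma init_mem: "u0 \<in> L2_on \<Omega>" and init_norm: "norm u0 = 1"
  using flow_mem[of 0] flow_norm[of 0] by (simp_all add: flow_0)

lemma active_exists: "\<exists>j. u0 \<bullet> e j \<noteq> 0"
proof (rule ccontr)
  assume "\<not> ?thesis"
  then have "u0 = 0"
    using init_mem subspace_0[OF subspace_H] by (intro eqI_coeff) auto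
  then show False using init_norm by simp
qed

lemma mu_star_mem: "\<mu> \<in> active_set lam e P u0"
  and mu_star_le: "u0 \<bullet> e j \<noteq> 0 \<Longrightarrow> \<mu> \<le> p j"
proof -
  have S: "active_set lam e P u0 \<subseteq> range p" "active_set lam e P u0 \<noteq> {}"
    using active_exists by (auto simp: active_set_def)
  show "\<mu> \<in> active_set lam e P u0"
    unfolding mu_star_def by (rule Least_unbounded_sequence(1)[OF unbounded S])
  show "\<mu> \<le> p j" if "u0 \<bullet> e j \<noteq> 0"
    unfolding mu_star_def
    by (rule Least_unbounded_sequence(2)[OF unbounded S]) (use that in \<open>auto simp: active_set_def\<close>)
qed

lemma H_star_iff: "v \<in> H_star \<Omega> lam e P u0 \<longleftrightarrow> v \<in> L2_on \<Omega> \<and> (\<forall>j. p j \<noteq> \<mu> \<longrightarrow> v \<bullet> e j = 0)"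
proof
  assume "v \<in> H_star \<Omega> lam e P u0"
  then have v: "v \<in> diag_dom \<Omega> e p" and eig: "diag_op e p v = \<mu> *\<^sub>R v"
    by (auto simp: H_star_def dom_PB_def PB_def)
  have "p j * (v \<bullet> e j) = \<mu> * (v \<bullet> e j)" for j
    using diag_op_coeff[OF v, of j] by (simp only: eig inner_scaleR_left)
  then show "v \<in> L2_on \<Omega> \<and> (\<forall>j. p j \<noteq> \<mu> \<longrightarrow> v \<bullet> e j = 0)"
    using diag_dom_mem[OF v] by (metis mult_cancel_right)
next
  assume v: "v \<in> L2_on \<Omega> \<and> (\<forall>j. p j \<noteq> \<mu> \<longrightarrow> v \<bullet> e j = 0)"
  then have pv: "p j * (v \<bullet> e j) = \<mu> * (v \<bullet> e j)" for j
    by (cases "p j = \<mu>") auto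
  have dom: "v \<in> diag_dom \<Omega> e p"
    using v summable_mult[OF Bessel[of v], of "\<mu>\<^sup>2"]
    by (simp add: diag_dom_iff pv power_mult_distrib)
  have "diag_op e p v = \<mu> *\<^sub>R v"
    using v subspace_scale[OF subspace_H]
    by (intro eqI_coeff diag_op_mem dom) (auto simp: diag_op_coeff[OF dom] pv)
  then show "v \<in> H_star \<Omega> lam e P u0"
    using dom by (simp add: H_star_def dom_PB_def PB_def)
qed

text \<open>The projection keeps exactly the coefficients with \<open>p j = \<mu>\<close>.  Testing orthogonality
  against the basis vectors that lie in \<open>H_star\<close> shows that it is unique, so the definite description in
  \<open>orth_proj\<close> denotes it.\<close>

lemma E_star_mem: "ws \<in> H_star \<Omega> lam e P u0"
  and E_star_coeff: "ws \<bullet> e j = (if p j = \<mu> then u0 \<bullet> e j else 0)"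
proof -
  define c where "c j = (if p j = \<mu> then u0 \<bullet> e j else 0)" for j
  define s where "s = (\<Sum>j. c j *\<^sub>R e j)"
  have c: "summable (\<lambda>j. (c j)\<^sup>2)"
    by (rule summable_comparison_test'[OF Bessel[of u0], where N = 0]) (simp add: c_def)
  have s: "s \<in> L2_on \<Omega>" "s \<bullet> e j = c j" for j
    unfolding s_def using c by (simp_all add: series_mem inner_series)
  have "ws = s"
    unfolding E_star_def orth_proj_def
  proof (rule the_equality, intro conjI ballI)
    show "s \<in> H_star \<Omega> lam e P u0" using s by (simp add: H_star_iff c_def)
    fix w assume w: "w \<in> H_star \<Omega> lam e P u0"
    have "(w \<bullet> e j) * ((u0 - s) \<bullet> e j) = 0" for j
      using w by (auto simp: H_star_iff inner_diff_left s c_def)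
    then have "(\<lambda>j. 0) sums (w \<bullet> (u0 - s))"
      using inner_sums[of w "u0 - s"] w by (simp only: H_star_iff)
    then show "(u0 - s) \<bullet> w = 0"
      using sums_unique2[OF sums_zero] by (simp add: inner_commute)
  next
    fix v assume v: "v \<in> H_star \<Omega> lam e P u0 \<and> (\<forall>w\<in>H_star \<Omega> lam e P u0. (u0 - v) \<bullet> w = 0)"
    show "v = s"
    proof (rule eqI_coeff)
      show "v \<in> L2_on \<Omega>" using v by (simp add: H_star_iff)
      show "v \<bullet> e j = s \<bullet> e j" for j
      proof (cases "p j = \<mu>")
        case True
        then have "e j \<in> H_star \<Omega> lam e P u0"
          by (auto simp: H_star_iff basis_mem inner_basis)
        then show ?thesis using v True by (simp add: s c_def inner_diff_left)
      next
        case False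
        then show ?thesis using v by (simp add: H_star_iff s c_def)
      qed
    qed (rule s)
  qed
  then show "ws \<in> H_star \<Omega> lam e P u0" "ws \<bullet> e j = (if p j = \<mu> then u0 \<bullet> e j else 0)"
    using s by (simp_all add: H_star_iff c_def)
qed

lemma ws_mem: "ws \<in> L2_on \<Omega>"
  using E_star_mem by (simp add: H_star_iff)

lemma wp_mem: "wp \<in> L2_on \<Omega>"
  by (intro subspace_diff subspace_H init_mem ws_mem)

lemma wp_coeff: "wp \<bullet> e j = (if p j = \<mu> then 0 else u0 \<bullet> e j)"
  by (simp add: inner_diff_left E_star_coeff)

lemma norm_ws_pos: "norm ws > 0"
proof -
  obtain j where "u0 \<bullet> e j \<noteq> 0" "p j = \<mu>"
    using mu_star_mem by (auto simp: active_set_def)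
  then have "ws \<bullet> e j \<noteq> 0" by (simp add: E_star_coeff)
  then show ?thesis by auto
qed

text \<open>In coordinates the equation reads
  \<open>u\<^sub>j' = (\<alpha> - p\<^sub>j) u\<^sub>j\<close> with the same Rayleigh quotient \<open>\<alpha> = \<langle>P(B)u, u\<rangle>\<close> for every \<open>j\<close>.
  Thus, up to a positive scalar \<open>\<phi> t\<close>, the solution is the linear semigroup applied to \<open>u0\<close>.\<close>

lemma flow_coeff:
  obtains \<phi> where "\<And>t. t \<ge> 0 \<Longrightarrow> \<phi> t > 0"
    "\<And>j t. t \<ge> 0 \<Longrightarrow> u t \<bullet> e j = (u0 \<bullet> e j) * exp (- p j * t) * \<phi> t"
proof -
  define \<alpha> where "\<alpha> t = PB lam e P (u t) \<bullet> u t" for t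
  obtain u' where
    u': "\<And>t. t > 0 \<Longrightarrow> (u has_vector_derivative u' t) (at t)"
      "\<And>t. t > 0 \<Longrightarrow> u' t = - tangent_proj (u t) (PB lam e P (u t))"
    and cont_u: "continuous_on {0..} u"
    and dom: "\<And>t. t > 0 \<Longrightarrow> u t \<in> diag_dom \<Omega> e p"
    and cont_PB: "continuous_on {0<..} (\<lambda>t. PB lam e P (u t))"
    using sol unfolding is_flow_solution_def dom_PB_def by blast
  have ode: "((\<lambda>t. u t \<bullet> e j) has_real_derivative (\<alpha> t - p j) * (u t \<bullet> e j)) (at t)"
    if "t > 0" for j t
  proof -
    have "u' t \<bullet> e j = (\<alpha> t - p j) * (u t \<bullet> e j)"
      using diag_op_coeff[OF dom[OF that], of j]
      by (simp add: u'(2)[OF that] tangent_proj_def \<alpha>_def PB_def inner_diff_left algebra_simps)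
    moreover have "((\<lambda>t. u t \<bullet> e j) has_vector_derivative u' t \<bullet> e j) (at t)"
      by (rule bounded_linear.has_vector_derivative[OF bounded_linear_inner_left u'(1)[OF that]])
    ultimately show ?thesis by (simp add: has_real_derivative_iff_has_vector_derivative)
  qed
  have cont: "continuous_on {0..} (\<lambda>t. u t \<bullet> e j)" for j
    by (intro continuous_intros cont_u)
  have cont_\<alpha>: "continuous_on {0<..} \<alpha>"
    unfolding \<alpha>_def by (intro continuous_on_inner cont_PB continuous_on_subset[OF cont_u]) auto
  obtain k where k: "u 0 \<bullet> e k \<noteq> 0" using active_exists by (auto simp: flow_0)
  show ?thesis
    using gauge_ode_solution[of "\<lambda>j t. u t \<bullet> e j" \<alpha> p k, OF ode cont cont_\<alpha> k] that
    by (simp only: flow_0) blast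
qed

text \<open>After multiplication by \<open>exp (\<mu> * t)\<close> the semigroup leaves the component \<open>ws\<close> fixed and damps \<open>wp\<close>
  to \<open>r\<close>; the constraint \<open>norm (u t) = 1\<close> then determines the scalar.\<close>

lemma flow_split:
  assumes "t \<ge> 0"
  obtains r where "r \<in> L2_on \<Omega>" "\<And>j. r \<bullet> e j = exp (- (p j - \<mu>) * t) * (wp \<bullet> e j)"
    "u t = (1 / norm (ws + r)) *\<^sub>R (ws + r)" "(norm (ws + r))\<^sup>2 = (norm ws)\<^sup>2 + (norm r)\<^sup>2"
proof -
  obtain \<phi> where \<phi>: "\<phi> t > 0" "\<And>j. u t \<bullet> e j = (u0 \<bullet> e j) * exp (- p j * t) * \<phi> t"
    using flow_coeff assms by metis
  define \<psi> where "\<psi> = exp (- \<mu> * t) * \<phi> t"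
  have \<psi>: "\<psi> > 0" using \<phi> by (simp add: \<psi>_def)
  define r where "r = (1 / \<psi>) *\<^sub>R u t - ws"
  have r: "r \<in> L2_on \<Omega>"
    unfolding r_def by (intro subspace_diff subspace_scale subspace_H flow_mem assms ws_mem)
  have "(u t \<bullet> e j) / \<psi> = exp (- (p j - \<mu>) * t) * (u0 \<bullet> e j)" for j
  proof -
    have "exp (- p j * t) = exp (- (p j - \<mu>) * t) * exp (- \<mu> * t)"
      by (simp add: algebra_simps flip: exp_add)
    then show ?thesis using \<phi> by (simp add: \<psi>_def)
  qed
  then have rj: "r \<bullet> e j = exp (- (p j - \<mu>) * t) * (wp \<bullet> e j)" for j
    by (simp add: r_def inner_diff_left E_star_coeff wp_coeff)
  \<comment> \<open>\<open>ws\<close> and \<open>r\<close> have disjoint supports in the eigenbasis, hence Pythagoras applies.\<close>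
  have "(\<lambda>j. (ws \<bullet> e j) * (r \<bullet> e j)) = (\<lambda>_. 0)"
    by (auto simp: rj wp_coeff E_star_coeff)
  then have "ws \<bullet> r = 0"
    using inner_sums[OF ws_mem, of r] sums_unique2[OF sums_zero] by simp
  then have pyth: "(norm (ws + r))\<^sup>2 = (norm ws)\<^sup>2 + (norm r)\<^sup>2"
    by (simp add: power2_norm_eq_inner inner_add_left inner_add_right inner_commute)
  have "u t = \<psi> *\<^sub>R (ws + r)" using \<psi> by (simp add: r_def)
  moreover from this have "\<psi> * norm (ws + r) = 1"
    using flow_norm[OF assms] \<psi> by simp
  then have "\<psi> = 1 / norm (ws + r)" using \<psi> by (metis divide_eq_eq mult_zero_right zero_neq_one eq_divide_eq)
  ultimately show ?thesis using that r rj pyth by metis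
qed

text \<open>Any such \<open>\<delta>\<close> is an admissible decay rate.  If \<open>\<mu>\<close> is the only active value then every positive
  number qualifies, so convergence can be proved without distinguishing whether the
  active gap exists.\<close>

definition spectral_gap :: "real \<Rightarrow> bool" where
  "spectral_gap \<delta> \<longleftrightarrow> \<delta> > 0 \<and> (\<forall>j. u0 \<bullet> e j \<noteq> 0 \<longrightarrow> p j \<noteq> \<mu> \<longrightarrow> \<mu> + \<delta> \<le> p j)"

text \<open>With \<open>a = norm ws\<close> and \<open>D = norm (ws + r)\<close> one has
  \<open>u t - uinf = (1 / D - 1 / a) *\<^sub>R ws + (1 / D) *\<^sub>R r\<close>.  The second term decays like \<open>r\<close>, the first like
  \<open>(norm r)\<^sup>2\<close>.  The estimate is for an arbitrary diagonal operator: multipliers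
  \<open>c j = (p j + \<kappa>) powr \<theta>\<close> give the graph norms, and \<open>c = (\<lambda>_. 1)\<close> gives the norm of the space.\<close>

lemma flow_decay:
  assumes gap: "spectral_gap \<delta>" and t: "t \<ge> 0" and dom: "u0 \<in> diag_dom \<Omega> e c"
  shows "u t \<in> diag_dom \<Omega> e c" "uinf \<in> diag_dom \<Omega> e c"
    "norm (diag_op e c (u t - uinf))
       \<le> (norm (diag_op e c wp) / norm ws
           + norm (diag_op e c ws) * (norm wp)\<^sup>2 / (2 * norm ws ^ 3)) * exp (- \<delta> * t)"
proof -
  define E where "E = exp (- \<delta> * t)"
  have E: "0 \<le> E" "E \<le> 1" using gap t by (auto simp: E_def spectral_gap_def)
  obtain r where r: "r \<in> L2_on \<Omega>" "\<And>j. r \<bullet> e j = exp (- (p j - \<mu>) * t) * (wp \<bullet> e j)"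
    and ut: "u t = (1 / norm (ws + r)) *\<^sub>R (ws + r)"
    and pyth: "(norm (ws + r))\<^sup>2 = (norm ws)\<^sup>2 + (norm r)\<^sup>2"
    using flow_split[OF t] by blast
  define a D where "a = norm ws" and "D = norm (ws + r)"
  have a: "a > 0" using norm_ws_pos by (simp add: a_def)
  have D: "a \<le> D" "\<bar>1 / D - 1 / a\<bar> \<le> (norm r)\<^sup>2 / (2 * a ^ 3)"
    using inverse_norm_gap[OF a, of D "norm r"] pyth by (simp_all add: a_def D_def)
  have ws: "ws \<in> diag_dom \<Omega> e c"
    by (rule diag_dom_dominated(1)[OF dom ws_mem, of 1]) (auto simp: E_star_coeff)
  have wp: "wp \<in> diag_dom \<Omega> e c"
    by (rule diag_dom_dominated(1)[OF dom wp_mem, of 1]) (auto simp: wp_coeff)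
  have rj: "\<bar>r \<bullet> e j\<bar> \<le> E * \<bar>wp \<bullet> e j\<bar>" for j
  proof (cases "wp \<bullet> e j = 0")
    case False
    then have "\<mu> + \<delta> \<le> p j" using gap by (auto simp: wp_coeff spectral_gap_def split: if_splits)
    then have "- (p j - \<mu>) * t \<le> - \<delta> * t" using t by (intro mult_right_mono) auto
    then show ?thesis by (simp add: r abs_mult E_def mult_right_mono)
  qed (simp add: r)
  have rdom: "r \<in> diag_dom \<Omega> e c" and Ar: "norm (diag_op e c r) \<le> E * norm (diag_op e c wp)"
    using diag_dom_dominated[OF wp r(1) E(1) rj] by auto
  have "norm r \<le> E * norm wp" by (rule norm_le_coeff[OF r(1) wp_mem E(1) rj])
  then have "(norm r)\<^sup>2 \<le> (E * norm wp)\<^sup>2" by (intro power_mono) auto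
  also have "\<dots> \<le> E * (norm wp)\<^sup>2"
    using mult_right_mono[OF mult_left_le[OF E(2,1)], of "(norm wp)\<^sup>2"]
    by (simp add: power_mult_distrib power2_eq_square[of E])
  finally have nr: "(norm r)\<^sup>2 \<le> E * (norm wp)\<^sup>2" .
  have ut': "u t = (1 / D) *\<^sub>R ws + (1 / D) *\<^sub>R r"
    using ut by (simp add: D_def scaleR_add_right)
  have uinf: "uinf = (1 / a) *\<^sub>R ws + 0 *\<^sub>R ws"
    by (simp add: u_infinity_def a_def divide_inverse)
  show "u t \<in> diag_dom \<Omega> e c" unfolding ut' by (intro diag_dom_lincomb ws rdom)
  show "uinf \<in> diag_dom \<Omega> e c" unfolding uinf by (intro diag_dom_lincomb ws)
  have diff: "u t - uinf = (1 / D - 1 / a) *\<^sub>R ws + (1 / D) *\<^sub>R r"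
    unfolding ut' uinf by (simp add: algebra_simps)
  have "norm (diag_op e c (u t - uinf))
      \<le> \<bar>1 / D - 1 / a\<bar> * norm (diag_op e c ws) + (1 / D) * norm (diag_op e c r)"
    unfolding diff diag_op_lincomb[OF ws rdom]
    by (rule norm_triangle_le) (use a D(1) in simp)
  also have "\<bar>1 / D - 1 / a\<bar> * norm (diag_op e c ws)
      \<le> (E * (norm wp)\<^sup>2 / (2 * a ^ 3)) * norm (diag_op e c ws)"
    using D(2) nr a by (intro mult_right_mono order_trans[OF D(2)] divide_right_mono) auto
  also have "(1 / D) * norm (diag_op e c r) \<le> (1 / a) * (E * norm (diag_op e c wp))"
    using a D(1) Ar by (intro mult_mono divide_left_mono) auto
  finally show "norm (diag_op e c (u t - uinf))
      \<le> (norm (diag_op e c wp) / norm ws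
          + norm (diag_op e c ws) * (norm wp)\<^sup>2 / (2 * norm ws ^ 3)) * exp (- \<delta> * t)"
    by (simp add: E_def a_def algebra_simps)
qed

lemma flow_tendsto:
  assumes gap: "spectral_gap \<delta>" and dom: "u0 \<in> diag_dom \<Omega> e c"
  shows "((\<lambda>t. norm (diag_op e c (u t - uinf))) \<longlongrightarrow> 0) at_top"
proof -
  define C where "C = norm (diag_op e c wp) / norm ws
           + norm (diag_op e c ws) * (norm wp)\<^sup>2 / (2 * norm ws ^ 3)"
  have "\<delta> > 0" using gap by (simp add: spectral_gap_def)
  then have "filterlim (\<lambda>t. - \<delta> * t) at_bot at_top"
    by (intro filterlim_tendsto_neg_mult_at_bot[OF tendsto_const _ filterlim_ident]) auto
  then have "((\<lambda>t. exp (- \<delta> * t)) \<longlongrightarrow> 0) at_top"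
    by (rule filterlim_compose[OF exp_at_bot])
  then have lim: "((\<lambda>t. C * exp (- \<delta> * t)) \<longlongrightarrow> 0) at_top"
    using tendsto_mult_right_zero by blast
  show ?thesis
  proof (rule tendsto_sandwich[OF _ _ tendsto_const lim])
    show "\<forall>\<^sub>F t in at_top. norm (diag_op e c (u t - uinf)) \<le> C * exp (- \<delta> * t)"
      using eventually_ge_at_top[of 0]
      by eventually_elim (use flow_decay(3)[OF gap _ dom] in \<open>simp add: C_def\<close>)
  qed simp
qed

lemma active_gap_spectral_gap:
  assumes "active_set lam e P u0 - {\<mu>} \<noteq> {}"
  shows "spectral_gap (active_gap lam e P u0)"
proof -
  let ?G = "{m - \<mu> | m. m \<in> active_set lam e P u0 \<and> m > \<mu>}"
  have unb: "filterlim (\<lambda>j. p j - \<mu>) at_top sequentially"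
    using filterlim_tendsto_add_at_top[OF tendsto_const[of "- \<mu>"] unbounded] by simp
  have mem: "p j - \<mu> \<in> ?G" if "u0 \<bullet> e j \<noteq> 0" "p j \<noteq> \<mu>" for j
    using that mu_star_le[OF that(1)] by (force simp: active_set_def)
  have G: "?G \<subseteq> range (\<lambda>j. p j - \<mu>)" "?G \<noteq> {}"
    using assms mem by (auto simp: active_set_def)
  have "active_gap lam e P u0 \<in> ?G"
    unfolding active_gap_def by (rule Least_unbounded_sequence(1)[OF unb G])
  moreover have "active_gap lam e P u0 \<le> p j - \<mu>" if "u0 \<bullet> e j \<noteq> 0" "p j \<noteq> \<mu>" for j
    unfolding active_gap_def by (rule Least_unbounded_sequence(2)[OF unb G mem[OF that]])
  ultimately show ?thesis by (force simp: spectral_gap_def)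
qed

lemma spectral_gap_trivial:
  assumes "active_set lam e P u0 = {\<mu>}"
  shows "spectral_gap 1"
  using assms by (auto simp: spectral_gap_def active_set_def)

lemma spectral_gap_exists: "\<exists>\<delta>. spectral_gap \<delta>"
  using active_gap_spectral_gap spectral_gap_trivial mu_star_mem by blast

lemma diag_op_wp_pos:
  assumes "active_set lam e P u0 - {\<mu>} \<noteq> {}" and dom: "u0 \<in> diag_dom \<Omega> e c" and c: "\<And>j. c j \<noteq> 0"
  shows "norm (diag_op e c wp) > 0"
proof -
  obtain j where "u0 \<bullet> e j \<noteq> 0" "p j \<noteq> \<mu>"
    using assms(1) by (auto simp: active_set_def)
  then have "wp \<bullet> e j \<noteq> 0" by (simp add: wp_coeff)
  moreover have "wp \<in> diag_dom \<Omega> e c"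
    by (rule diag_dom_dominated(1)[OF dom wp_mem, of 1]) (auto simp: wp_coeff)
  ultimately have "diag_op e c wp \<bullet> e j \<noteq> 0" by (simp add: diag_op_coeff c)
  then show ?thesis by auto
qed

lemma decay_constant_pos:
  assumes "active_set lam e P u0 - {\<mu>} \<noteq> {}" "u0 \<in> diag_dom \<Omega> e c" "\<And>j. c j \<noteq> 0"
  shows "norm (diag_op e c wp) / norm ws
           + norm (diag_op e c ws) * (norm wp)\<^sup>2 / (2 * norm ws ^ 3) > 0"
  using diag_op_wp_pos[OF assms] norm_ws_pos by (intro add_pos_nonneg divide_pos_pos) auto

text \<open>Here \<open>wp = 0\<close>, so the constant in the decay estimate vanishes and \<open>u\<close> equals \<open>uinf\<close> at all times.\<close>

lemma flow_stationary:
  assumes "active_set lam e P u0 = {\<mu>}" and t: "t \<ge> 0"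
  shows "u t = u0"
proof -
  have one: "u0 \<in> diag_dom \<Omega> e (\<lambda>_. 1)" using init_mem by (simp add: diag_dom_one)
  have "wp \<bullet> e j = 0" for j
    using assms by (auto simp: wp_coeff active_set_def)
  then have "wp = 0"
    using wp_mem subspace_0[OF subspace_H] by (intro eqI_coeff) auto
  have "u s = uinf" if s: "s \<ge> 0" for s
  proof -
    note fd = flow_decay[OF spectral_gap_trivial[OF assms(1)] s one]
    have "u s - uinf \<in> L2_on \<Omega>"
      using fd(1,2) by (intro subspace_diff subspace_H) (auto simp: diag_dom_one)
    then show ?thesis
      using fd(3) by (simp add: diag_op_one \<open>wp = 0\<close> subspace_0[OF subspace_H])
  qed
  from this[OF t] this[of 0] show ?thesis by (simp add: flow_0)
qed

lemma uinf_mem: "uinf \<in> H_star \<Omega> lam e P u0 \<inter> unit_sphere \<Omega>"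
  using E_star_mem norm_ws_pos
  by (auto simp: H_star_iff unit_sphere_def u_infinity_def subspace_scale[OF subspace_H])

lemma uinf_equilibrium: "tangent_proj uinf (PB lam e P uinf) = 0"
proof -
  have "PB lam e P uinf = \<mu> *\<^sub>R uinf" and "uinf \<bullet> uinf = 1"
    using uinf_mem by (auto simp: H_star_def unit_sphere_def simp flip: power2_norm_eq_inner)
  then show ?thesis by (simp add: tangent_proj_def)
qed

end

section \<open>Convergence to the lowest active eigenspace\<close>

theorem theorem3p11:
  fixes \<Omega> :: "'a::euclidean_space set"
    and lam :: "nat \<Rightarrow> real" and e :: "nat \<Rightarrow> 'a L2"
    and P :: "real poly" and \<kappa> :: real
    and u0 :: "'a L2" and u :: "real \<Rightarrow> 'a L2"
  assumes "smooth_bounded_domain \<Omega>"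
    and "dirichlet_eigensystem \<Omega> lam e"
    and "degree P \<ge> 1" and "lead_coeff P > 0"
    and "\<kappa> > max 0 (1 - mu_P lam P)"
    and "u0 \<in> unit_sphere \<Omega>"
    and "is_flow_solution \<Omega> lam e P u0 u"
  shows
    "(u \<longlongrightarrow> u_infinity \<Omega> lam e P u0) at_top
     \<and> u_infinity \<Omega> lam e P u0 \<in> H_star \<Omega> lam e P u0 \<inter> unit_sphere \<Omega>
     \<and> u_infinity \<Omega> lam e P u0 \<in> dom_PB \<Omega> lam e P
     \<and> tangent_proj (u_infinity \<Omega> lam e P u0) (PB lam e P (u_infinity \<Omega> lam e P u0)) = 0
     \<and> (active_set lam e P u0 - {mu_star lam e P u0} \<noteq> {} \<longrightarrow>
          active_gap lam e P u0 > 0 \<and>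
          (\<exists>C>0. \<forall>t\<ge>0. norm (u t - u_infinity \<Omega> lam e P u0)
                          \<le> C * exp (- active_gap lam e P u0 * t)))
     \<and> (active_set lam e P u0 = {mu_star lam e P u0} \<longrightarrow> (\<forall>t\<ge>0. u t = u0))
     \<and> (\<forall>\<theta>\<ge>0. u0 \<in> dom_A_pow \<Omega> lam e P \<kappa> \<theta> \<longrightarrow>
          (\<forall>t\<ge>0. u t \<in> dom_A_pow \<Omega> lam e P \<kappa> \<theta>)
          \<and> u_infinity \<Omega> lam e P u0 \<in> dom_A_pow \<Omega> lam e P \<kappa> \<theta>
          \<and> ((\<lambda>t. norm (A_pow lam e P \<kappa> \<theta> (u t - u_infinity \<Omega> lam e P u0))) \<longlongrightarrow> 0) at_top
          \<and> (active_set lam e P u0 - {mu_star lam e P u0} \<noteq> {} \<longrightarrow>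
               (\<exists>C>0. C = C_theta \<Omega> lam e P \<kappa> \<theta> u0 \<and>
                  (\<forall>t\<ge>0. norm (A_pow lam e P \<kappa> \<theta> (u t - u_infinity \<Omega> lam e P u0))
                            \<le> C * exp (- active_gap lam e P u0 * t)))))"
proof -
  have eig: "orthonormal_basis_of (L2_on \<Omega>) e" "incseq lam" "filterlim lam at_top sequentially"
    using assms(2) by (auto simp: dirichlet_eigensystem_def)
  interpret normalized_flow \<Omega> e lam P u0 u
  proof
    show "filterlim (\<lambda>j. poly P (lam j)) at_top sequentially"
      by (rule filterlim_compose[OF poly_at_top[OF assms(3,4)] eig(3)])
  qed (rule eig(1), rule assms(7))
  obtain \<delta> where \<delta>: "spectral_gap \<delta>" using spectral_gap_exists by blast
  have one: "u0 \<in> diag_dom \<Omega> e (\<lambda>_. 1)" using init_mem by (simp add: diag_dom_one)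
  have diff_mem: "u t - uinf \<in> L2_on \<Omega>" if "t \<ge> 0" for t
    using flow_mem[OF that] uinf_mem by (intro subspace_diff subspace_H) (auto simp: unit_sphere_def)
  have conv: "(u \<longlongrightarrow> uinf) at_top"
  proof -
    have "((\<lambda>t. norm (u t - uinf)) \<longlongrightarrow> 0) at_top"
    proof (rule Lim_transform_eventually[OF flow_tendsto[OF \<delta> one]])
      show "\<forall>\<^sub>F t in at_top. norm (diag_op e (\<lambda>_. 1) (u t - uinf)) = norm (u t - uinf)"
        using eventually_ge_at_top[of 0] by eventually_elim (simp add: diag_op_one diff_mem)
    qed
    then show ?thesis by (simp add: tendsto_norm_zero_iff LIM_zero_iff)
  qed
  have rate: "active_gap lam e P u0 > 0 \<and>
      (\<exists>C>0. \<forall>t\<ge>0. norm (u t - uinf) \<le> C * exp (- active_gap lam e P u0 * t))"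
    if ne: "active_set lam e P u0 - {\<mu>} \<noteq> {}"
  proof
    note gap = active_gap_spectral_gap[OF ne]
    show "active_gap lam e P u0 > 0" using gap by (simp add: spectral_gap_def)
    show "\<exists>C>0. \<forall>t\<ge>0. norm (u t - uinf) \<le> C * exp (- active_gap lam e P u0 * t)"
    proof (intro exI conjI allI impI)
      show "norm (diag_op e (\<lambda>_. 1) wp) / norm ws
           + norm (diag_op e (\<lambda>_. 1) ws) * (norm wp)\<^sup>2 / (2 * norm ws ^ 3) > 0"
        by (rule decay_constant_pos[OF ne one]) simp
      fix t :: real assume t: "t \<ge> 0"
      show "norm (u t - uinf) \<le> (norm (diag_op e (\<lambda>_. 1) wp) / norm ws
           + norm (diag_op e (\<lambda>_. 1) ws) * (norm wp)\<^sup>2 / (2 * norm ws ^ 3))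
           * exp (- active_gap lam e P u0 * t)"
        using flow_decay(3)[OF gap t one] unfolding diag_op_one[OF diff_mem[OF t]] .
    qed
  qed
  \<comment> \<open>The multipliers of the powers of \<open>A\<close> are nonzero, which makes the constants strictly positive.\<close>
  have q_pos: "p j + \<kappa> > 0" for j
  proof -
    have "mu_P lam P \<le> p j"
      by (rule mu_P_le[OF assms(3,4)]) (rule incseqD[OF eig(2)], simp)
    then show ?thesis using assms(5) by simp
  qed
  have graph: "(\<forall>t\<ge>0. u t \<in> dom_A_pow \<Omega> lam e P \<kappa> \<theta>)
      \<and> uinf \<in> dom_A_pow \<Omega> lam e P \<kappa> \<theta>
      \<and> ((\<lambda>t. norm (A_pow lam e P \<kappa> \<theta> (u t - uinf))) \<longlongrightarrow> 0) at_top
      \<and> (active_set lam e P u0 - {\<mu>} \<noteq> {} \<longrightarrow>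
           (\<exists>C>0. C = C_theta \<Omega> lam e P \<kappa> \<theta> u0 \<and>
              (\<forall>t\<ge>0. norm (A_pow lam e P \<kappa> \<theta> (u t - uinf)) \<le> C * exp (- active_gap lam e P u0 * t))))"
    if "u0 \<in> dom_A_pow \<Omega> lam e P \<kappa> \<theta>" for \<theta>
  proof -
    define c where "c = (\<lambda>j. (p j + \<kappa>) powr \<theta>)"
    have dom_eq: "dom_A_pow \<Omega> lam e P \<kappa> \<theta> = diag_dom \<Omega> e c"
      and op_eq: "A_pow lam e P \<kappa> \<theta> = diag_op e c"
      by (simp_all add: dom_A_pow_def A_pow_def c_def)
    have dom: "u0 \<in> diag_dom \<Omega> e c" using that by (simp add: dom_eq)
    have c: "c j \<noteq> 0" for j using q_pos[of j] by (simp add: c_def)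
    have C_eq: "C_theta \<Omega> lam e P \<kappa> \<theta> u0 = norm (diag_op e c wp) / norm ws
           + norm (diag_op e c ws) * (norm wp)\<^sup>2 / (2 * norm ws ^ 3)"
      by (simp add: C_theta_def Let_def op_eq)
    show ?thesis
      unfolding dom_eq op_eq
    proof (intro conjI impI allI exI[of _ "C_theta \<Omega> lam e P \<kappa> \<theta> u0"])
      show "u t \<in> diag_dom \<Omega> e c" if "t \<ge> 0" for t by (rule flow_decay(1)[OF \<delta> that dom])
      show "uinf \<in> diag_dom \<Omega> e c" by (rule flow_decay(2)[OF \<delta> order_refl dom])
      show "((\<lambda>t. norm (diag_op e c (u t - uinf))) \<longlongrightarrow> 0) at_top" by (rule flow_tendsto[OF \<delta> dom])
      assume ne: "active_set lam e P u0 - {\<mu>} \<noteq> {}"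
      show "0 < C_theta \<Omega> lam e P \<kappa> \<theta> u0" unfolding C_eq by (rule decay_constant_pos[OF ne dom c])
      show "norm (diag_op e c (u t - uinf)) \<le> C_theta \<Omega> lam e P \<kappa> \<theta> u0 * exp (- active_gap lam e P u0 * t)"
        if "t \<ge> 0" for t
        unfolding C_eq by (rule flow_decay(3)[OF active_gap_spectral_gap[OF ne] that dom])
    qed (rule refl)
  qed
  have "uinf \<in> dom_PB \<Omega> lam e P" using uinf_mem by (simp add: H_star_def)
  then show ?thesis
    using conv uinf_mem uinf_equilibrium rate flow_stationary graph by blast
qed

end
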